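(* Let $V,W$ be real vector spaces and let $n>0$ be an integer. The following canonical identifications hold. (1) $S_+(V)^*=S_+(V^* )$. (2) $S_+(V)\otimes S_+(W)$ is the convex cone over the Segre-Veronese embedding of $\mathbb{P}(V)\times\mathbb{P}(W)$ in $\mathbb{P}(\mathrm{Sym}^2(V)\otimes\mathrm{Sym}^2(W))$. $\mathrm{Sym}^n(S_+(V))$ is the convex cone over the $n$-th Veronese re-embedding of the second Veronese embedding of $\mathbb{P}(V)$ in $\mathrm{Sym}^n(\mathrm{Sym}^2(V))$. (3) $(S_+(V)\otimes S_+(W))^*=\mathrm{Hom}_{\mathcal{AC}}(S_+(V),S_+(W^* ))=P_{(2,2)}(V^*,W^* )$, where $P_{(2,2)}(V^*,W^* )$ is the set of nonnegative polynomials in $\mathrm{Sym}^2(V^* )\otimes\mathrm{Sym}^2(W^* )$ (i.e. of bidegree $(2,2)$). More generally the dual of the tensor product of $n$ PSD cones is the set of nonnegative polynomials of degree $(2,\dots,2)$ in $n$ disjoint sets of variables. (4) $\mathrm{Sym}^n(S_+(V))^*$ is the set of nonnegative polynomials of degree $(2,\dots,2)$ in $n$ sets of variables of the same size which are invariant under permutations of these sets of variables.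
   Context: All vector spaces are finite-dimensional. $S_+(U)\subseteq\mathrm{Sym}^2(U)$ is the cone of sums of squares of elements of $U$ (the PSD cone). For a cone $C\subseteq LC$, $C^*=\{\phi\in(LC)^*:\phi\ge0\text{ on }C\}$. $\mathrm{Hom}_{\mathcal{AC}}(C_1,C_2)$ is the cone of linear maps $f:LC_1\to LC_2$ with $f(C_1)\subseteq C_2$. $C_1\otimes C_2:=\mathrm{Cone}\{c_1\otimes c_2:c_i\in C_i\}$ and $\mathrm{Sym}^n(C):=\mathrm{Cone}\{v_1\cdots v_n:v_i\in C\}$. The space $\mathrm{Sym}^2(V)$ is identified with $\mathrm{Sym}^2(V^* )^*$ via the nondegenerate pairing $\mathrm{Sym}^2(V^* )\times\mathrm{Sym}^2(V)\to\mathbb{R}$, $(fg,uv)\mapsto\frac{f(u)g(v)+f(v)g(u)}2$, so $u^2$ acts on $\mathrm{Sym}^2(V^* )$ as evaluation at $u$; hence $v^2\otimes w^2$ acts on $\mathrm{Sym}^2(V^* )\otimes\mathrm{Sym}^2(W^* )$ as evaluation at $(v,w)$. The Segre-Veronese embedding sends $(v,w)$ to $v^2\otimes w^2$, and the convex cone over it is the cone generated by the elements $v^2\otimes w^2$; the second Veronese embedding sends $v$ to $v^2$ and the $n$-th Veronese sends $u$ to $u^n$. The elements of $\mathrm{Sym}^n(S_+(V))^*$ are viewed as polynomials on $V^n$ by evaluation on products $v_1^2\cdots v_n^2$.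
   Formalization: In (2), the claim that Sym^n(S_+(V)) is the cone over the n-th Veronese of the second Veronese is false for n≥2, dim V≥2; it is replaced by generation by products v_1^2...v_n^2, containment of the cone of powers (v^2)^n, and equality when n=1 or dim V≤1. *)

theory Defs
  imports "HOL-Analysis.Analysis" "HOL-Library.Function_Algebras"
begin

section \<open>Functions as a real vector space\<close>

instantiation "fun" :: (type, real_vector) real_vector
begin

definition scaleR_fun :: "real \<Rightarrow> ('a \<Rightarrow> 'b) \<Rightarrow> 'a \<Rightarrow> 'b"
  where "scaleR_fun c f = (\<lambda>x. c *\<^sub>R f x)"

instance
  by standard (simp_all add: scaleR_fun_def fun_eq_iff algebra_simps)

end

lemma scaleR_fun_apply [simp]: "(c *\<^sub>R f) x = c *\<^sub>R f x"
  by (simp add: scaleR_fun_def)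

section \<open>Linear maps and duals\<close>

text \<open>A finite-dimensional vector space is a finite-dimensional subspace of an arbitrary real
  vector space, the ambient type.  Since the ambient space is arbitrary, this is no restriction; the
  zero space is included, and the members of a family of spaces may have different dimensions.\<close>

definition fin_dim :: "'a::real_vector set \<Rightarrow> bool"
  where "fin_dim V \<longleftrightarrow> (\<exists>B. finite B \<and> V = span B)"

definition linear_on :: "'a::real_vector set \<Rightarrow> ('a \<Rightarrow> 'b::real_vector) \<Rightarrow> bool"
  where "linear_on V f \<longleftrightarrow>
    (\<forall>x\<in>V. \<forall>y\<in>V. f (x + y) = f x + f y) \<and> (\<forall>c. \<forall>x\<in>V. f (c *\<^sub>R x) = c *\<^sub>R f x)"

text \<open>Linear maps on \<open>V\<close> are represented by functions vanishing outside \<open>V\<close>, so that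
  they correspond one-to-one to their representatives.\<close>

definition lin_maps :: "'a::real_vector set \<Rightarrow> 'b::real_vector set \<Rightarrow> ('a \<Rightarrow> 'b) set"
  where "lin_maps V W = {f. linear_on V f \<and> f ` V \<subseteq> W \<and> (\<forall>x. x \<notin> V \<longrightarrow> f x = 0)}"

definition dual :: "'a::real_vector set \<Rightarrow> ('a \<Rightarrow> real) set"
  where "dual V = lin_maps V UNIV"

section \<open>Tensor products and symmetric powers\<close>

text \<open>The tensor product is realised as the span of the functionals \<open>\<beta> \<mapsto> \<beta>(v,w)\<close> on the bilinear
  forms \<open>\<beta>\<close> on \<open>V \<times> W\<close>, and the symmetric powers likewise with symmetric multilinear
  forms.  The universal properties are proved below.  Forms are total functions of which
  only the values on \<open>V \<times> W\<close> matter; functions that are not forms are sent to \<open>0\<close>.\<close>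

type_synonym ('a, 'b) tensors = "('a \<Rightarrow> 'b \<Rightarrow> real) \<Rightarrow> real"
type_synonym 'a sym2 = "('a \<Rightarrow> 'a \<Rightarrow> real) \<Rightarrow> real"
type_synonym ('n, 'a) multi_tensors = "(('n \<Rightarrow> 'a) \<Rightarrow> real) \<Rightarrow> real"

definition bilinear_on ::
    "'a::real_vector set \<Rightarrow> 'b::real_vector set \<Rightarrow> ('a \<Rightarrow> 'b \<Rightarrow> 'c::real_vector) \<Rightarrow> bool"
  where "bilinear_on V W \<beta> \<longleftrightarrow>
    (\<forall>v\<in>V. linear_on W (\<beta> v)) \<and> (\<forall>w\<in>W. linear_on V (\<lambda>v. \<beta> v w))"

definition tensor ::
    "'a::real_vector set \<Rightarrow> 'b::real_vector set \<Rightarrow> 'a \<Rightarrow> 'b \<Rightarrow> ('a, 'b) tensors"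
  where "tensor V W v w = (\<lambda>\<beta>. if bilinear_on V W \<beta> then \<beta> v w else 0)"

definition tensor_space ::
    "'a::real_vector set \<Rightarrow> 'b::real_vector set \<Rightarrow> ('a, 'b) tensors set"
  where "tensor_space V W = span {tensor V W v w | v w. v \<in> V \<and> w \<in> W}"

definition sym_bilinear_on ::
    "'a::real_vector set \<Rightarrow> ('a \<Rightarrow> 'a \<Rightarrow> 'c::real_vector) \<Rightarrow> bool"
  where "sym_bilinear_on V \<beta> \<longleftrightarrow> bilinear_on V V \<beta> \<and> (\<forall>u\<in>V. \<forall>v\<in>V. \<beta> u v = \<beta> v u)"

text \<open>\<open>sym2_mult V u v\<close> is the product \<open>uv\<close> in the symmetric square of \<open>V\<close>.\<close>

definition sym2_mult :: "'a::real_vector set \<Rightarrow> 'a \<Rightarrow> 'a \<Rightarrow> 'a sym2"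
  where "sym2_mult V u v = (\<lambda>\<beta>. if sym_bilinear_on V \<beta> then \<beta> u v else 0)"

definition Sym2 :: "'a::real_vector set \<Rightarrow> 'a sym2 set"
  where "Sym2 V = span {sym2_mult V u v | u v. u \<in> V \<and> v \<in> V}"

abbreviation sq :: "'a::real_vector set \<Rightarrow> 'a \<Rightarrow> 'a sym2"
  where "sq V v \<equiv> sym2_mult V v v"

definition multilinear_on ::
    "('n::finite \<Rightarrow> 'a::real_vector set) \<Rightarrow> (('n \<Rightarrow> 'a) \<Rightarrow> 'c::real_vector) \<Rightarrow> bool"
  where "multilinear_on V m \<longleftrightarrow>
    (\<forall>u. (\<forall>i. u i \<in> V i) \<longrightarrow> (\<forall>k. linear_on (V k) (\<lambda>x. m (u(k := x)))))"

text \<open>\<open>multi_tensor V u\<close> is the tensor product of the \<open>u i \<in> V i\<close> over all \<open>i :: 'n\<close>.\<close>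

definition multi_tensor ::
    "('n::finite \<Rightarrow> 'a::real_vector set) \<Rightarrow> ('n \<Rightarrow> 'a) \<Rightarrow> ('n, 'a) multi_tensors"
  where "multi_tensor V u = (\<lambda>m. if multilinear_on V m then m u else 0)"

definition multi_tensor_space ::
    "('n::finite \<Rightarrow> 'a::real_vector set) \<Rightarrow> ('n, 'a) multi_tensors set"
  where "multi_tensor_space V = span {multi_tensor V u | u. \<forall>i. u i \<in> V i}"

definition sym_multilinear_on ::
    "'a::real_vector set \<Rightarrow> (('n::finite \<Rightarrow> 'a) \<Rightarrow> 'c::real_vector) \<Rightarrow> bool"
  where "sym_multilinear_on V m \<longleftrightarrow> multilinear_on (\<lambda>_. V) m \<and>
    (\<forall>\<pi> u. \<pi> permutes UNIV \<longrightarrow> (\<forall>i. u i \<in> V) \<longrightarrow> m (u \<circ> \<pi>) = m u)"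

text \<open>\<open>sym_prod V u\<close> is the product of the \<open>u i\<close>, \<open>i :: 'n\<close>, in the symmetric power of \<open>V\<close> of
  exponent \<open>CARD('n)\<close>.\<close>

definition sym_prod ::
    "'a::real_vector set \<Rightarrow> ('n::finite \<Rightarrow> 'a) \<Rightarrow> ('n, 'a) multi_tensors"
  where "sym_prod V u = (\<lambda>m. if sym_multilinear_on V m then m u else 0)"

definition sym_power :: "'a::real_vector set \<Rightarrow> ('n::finite, 'a) multi_tensors set"
  where "sym_power V = span {sym_prod V u | u. \<forall>i. u i \<in> V}"

section \<open>Cones\<close>

definition dual_cone :: "'a::real_vector set \<Rightarrow> ('a \<Rightarrow> real) set"
  where "dual_cone C = {\<phi> \<in> dual (span C). \<forall>c\<in>C. 0 \<le> \<phi> c}"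

definition Hom_AC :: "'a::real_vector set \<Rightarrow> 'b::real_vector set \<Rightarrow> ('a \<Rightarrow> 'b) set"
  where "Hom_AC C D = {f \<in> lin_maps (span C) (span D). f ` C \<subseteq> D}"

definition tensor_cone ::
    "'a::real_vector set \<Rightarrow> 'b::real_vector set \<Rightarrow> ('a, 'b) tensors set"
  where "tensor_cone C D =
    convex_cone hull {tensor (span C) (span D) c d | c d. c \<in> C \<and> d \<in> D}"

definition multi_tensor_cone ::
    "('n::finite \<Rightarrow> 'a::real_vector set) \<Rightarrow> ('n, 'a) multi_tensors set"
  where "multi_tensor_cone C =
    convex_cone hull {multi_tensor (\<lambda>i. span (C i)) c | c. \<forall>i. c i \<in> C i}"

definition sym_cone :: "'a::real_vector set \<Rightarrow> ('n::finite, 'a) multi_tensors set"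
  where "sym_cone C = convex_cone hull {sym_prod (span C) c | c. \<forall>i. c i \<in> C}"

definition psd :: "'a::real_vector set \<Rightarrow> 'a sym2 set"
  where "psd V = {\<Sum>k<m. sq V (u k) | (m::nat) u. \<forall>k<m. u k \<in> V}"

text \<open>The map \<open>\<Phi>\<close> identifies the vector space \<open>X\<close> with \<open>Y\<close> and, inside them, the cone \<open>C\<close>
  with \<open>D\<close>.\<close>

definition identifies ::
    "('a::real_vector \<Rightarrow> 'b::real_vector) \<Rightarrow> 'a set \<Rightarrow> 'a set \<Rightarrow> 'b set \<Rightarrow> 'b set \<Rightarrow> bool"
  where "identifies \<Phi> X C Y D \<longleftrightarrow>
    linear_on X \<Phi> \<and> bij_betw \<Phi> X Y \<and> C \<subseteq> X \<and> D \<subseteq> Y \<and> \<Phi> ` C = D"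

section \<open>The canonical maps\<close>

text \<open>An element of a tensor product or symmetric power is applied to a form \<open>\<beta>\<close> to obtain
  the value at that element of the linear functional induced by \<open>\<beta>\<close>.\<close>

text \<open>The functional on \<open>Sym2 V\<close> defined by an element of \<open>Sym2 (dual V)\<close> through the pairing
  \<open>(fg, uv) \<mapsto> (f(u) g(v) + f(v) g(u)) / 2\<close>; see \<open>sym2_pairing_mult\<close> below.\<close>

definition sym2_pairing ::
    "'a::real_vector set \<Rightarrow> ('a \<Rightarrow> real) sym2 \<Rightarrow> 'a sym2 \<Rightarrow> real"
  where "sym2_pairing V P = (\<lambda>A. if A \<in> Sym2 V
    then P (\<lambda>f g. A (\<lambda>u v. (f u * g v + f v * g u) / 2)) else 0)"

text \<open>\<open>P \<otimes> R\<close> acts on \<open>A \<otimes> B\<close> as the product of the pairings of \<open>P\<close> with \<open>A\<close> and of \<open>R\<close> with \<open>B\<close>.\<close>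

definition tensor_pairing ::
    "'a::real_vector set \<Rightarrow> 'b::real_vector set \<Rightarrow> (('a \<Rightarrow> real) sym2, ('b \<Rightarrow> real) sym2) tensors
      \<Rightarrow> ('a sym2, 'b sym2) tensors \<Rightarrow> real"
  where "tensor_pairing V W Q = (\<lambda>T. if T \<in> tensor_space (Sym2 V) (Sym2 W)
    then Q (\<lambda>P R. T (\<lambda>A B. sym2_pairing V P A * sym2_pairing W R B)) else 0)"

definition multi_tensor_pairing ::
    "('n::finite \<Rightarrow> 'a::real_vector set) \<Rightarrow> ('n, ('a \<Rightarrow> real) sym2) multi_tensors
      \<Rightarrow> ('n, 'a sym2) multi_tensors \<Rightarrow> real"
  where "multi_tensor_pairing V Q = (\<lambda>T. if T \<in> multi_tensor_space (\<lambda>i. Sym2 (V i))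
    then Q (\<lambda>P. T (\<lambda>A. \<Prod>i\<in>UNIV. sym2_pairing (V i) (P i) (A i))) else 0)"

text \<open>A linear map \<open>h\<close> from \<open>Sym2 V\<close> to \<open>Sym2 (dual W)\<close> acts on \<open>A \<otimes> B\<close> as the
  pairing of \<open>h A\<close> with \<open>B\<close>.\<close>

definition hom_pairing ::
    "'a::real_vector set \<Rightarrow> 'b::real_vector set \<Rightarrow> ('a sym2 \<Rightarrow> ('b \<Rightarrow> real) sym2)
      \<Rightarrow> ('a sym2, 'b sym2) tensors \<Rightarrow> real"
  where "hom_pairing V W h = (\<lambda>T. if T \<in> tensor_space (Sym2 V) (Sym2 W)
    then T (\<lambda>A B. sym2_pairing W (h A) B) else 0)"

section \<open>Polynomials\<close>

text \<open>Evaluation at a point of the quadratic form \<open>P \<in> Sym2 (dual V)\<close>, in which \<open>fg\<close> takes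
  the value \<open>f(v) g(v)\<close> at \<open>v\<close>, and of polynomials in tensor products of spaces of
  quadratic forms, in which \<open>P \<otimes> R\<close> takes the value \<open>P(v) R(w)\<close> at \<open>(v,w)\<close>.\<close>

definition quad_eval :: "('a \<Rightarrow> real) sym2 \<Rightarrow> 'a \<Rightarrow> real"
  where "quad_eval P v = P (\<lambda>f g. f v * g v)"

definition biquad_eval :: "(('a \<Rightarrow> real) sym2, ('b \<Rightarrow> real) sym2) tensors \<Rightarrow> 'a \<Rightarrow> 'b \<Rightarrow> real"
  where "biquad_eval Q v w = Q (\<lambda>P R. quad_eval P v * quad_eval R w)"

definition multiquad_eval :: "('n::finite, ('a \<Rightarrow> real) sym2) multi_tensors \<Rightarrow> ('n \<Rightarrow> 'a) \<Rightarrow> real"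
  where "multiquad_eval Q v = Q (\<lambda>P. \<Prod>i\<in>UNIV. quad_eval (P i) (v i))"

abbreviation biquad_polys :: "'a::real_vector set \<Rightarrow> 'b::real_vector set
    \<Rightarrow> (('a \<Rightarrow> real) sym2, ('b \<Rightarrow> real) sym2) tensors set"
  where "biquad_polys V W \<equiv> tensor_space (Sym2 (dual V)) (Sym2 (dual W))"

definition nonneg_biquad_polys :: "'a::real_vector set \<Rightarrow> 'b::real_vector set
    \<Rightarrow> (('a \<Rightarrow> real) sym2, ('b \<Rightarrow> real) sym2) tensors set"
  where "nonneg_biquad_polys V W =
    {Q \<in> biquad_polys V W. \<forall>v\<in>V. \<forall>w\<in>W. 0 \<le> biquad_eval Q v w}"

abbreviation multiquad_polys :: "('n::finite \<Rightarrow> 'a::real_vector set)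
    \<Rightarrow> ('n, ('a \<Rightarrow> real) sym2) multi_tensors set"
  where "multiquad_polys V \<equiv> multi_tensor_space (\<lambda>i. Sym2 (dual (V i)))"

definition nonneg_multiquad_polys :: "('n::finite \<Rightarrow> 'a::real_vector set)
    \<Rightarrow> ('n, ('a \<Rightarrow> real) sym2) multi_tensors set"
  where "nonneg_multiquad_polys V =
    {Q \<in> multiquad_polys V. \<forall>v. (\<forall>i. v i \<in> V i) \<longrightarrow> 0 \<le> multiquad_eval Q v}"

text \<open>The polynomial function on the power of \<open>V\<close> with exponent \<open>CARD('n)\<close> given by \<open>Q\<close>, and
  the one given by a functional on the symmetric power of \<open>Sym2 V\<close> through its values
  on products of squares.  Both are set to \<open>0\<close> outside the power of \<open>V\<close>.\<close>

definition poly_fun ::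
    "'a::real_vector set \<Rightarrow> ('n::finite, ('a \<Rightarrow> real) sym2) multi_tensors \<Rightarrow> ('n \<Rightarrow> 'a) \<Rightarrow> real"
  where "poly_fun V Q = (\<lambda>v. if \<forall>i. v i \<in> V then multiquad_eval Q v else 0)"

definition square_eval ::
    "'a::real_vector set \<Rightarrow> (('n::finite, 'a sym2) multi_tensors \<Rightarrow> real) \<Rightarrow> ('n \<Rightarrow> 'a) \<Rightarrow> real"
  where "square_eval V \<phi> =
    (\<lambda>v. if \<forall>i. v i \<in> V then \<phi> (sym_prod (Sym2 V) (\<lambda>i. sq V (v i))) else 0)"

definition perm_invariant :: "(('n::finite \<Rightarrow> 'a) \<Rightarrow> real) \<Rightarrow> bool"
  where "perm_invariant F \<longleftrightarrow> (\<forall>\<pi> v. \<pi> permutes UNIV \<longrightarrow> F (v \<circ> \<pi>) = F v)"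

section \<open>Universal properties\<close>

lemma factor_through:
  fixes g :: "'x \<Rightarrow> 'z::real_vector" and \<tau> :: "'x \<Rightarrow> 't::real_vector"
  assumes "\<And>l :: 'z \<Rightarrow> real. linear l \<Longrightarrow> \<exists>L :: 't \<Rightarrow> real. linear L \<and> (\<forall>x\<in>X. L (\<tau> x) = l (g x))"
  shows "\<exists>f. linear f \<and> (\<forall>x\<in>X. f (\<tau> x) = g x)"
proof -
  obtain B where B: "B \<subseteq> \<tau> ` X" "independent B" "\<tau> ` X \<subseteq> span B"
    using maximal_independent_subset[of "\<tau> ` X"] by blast
  define s where "s b = (SOME x. x \<in> X \<and> \<tau> x = b)" for b
  have s: "s b \<in> X \<and> \<tau> (s b) = b" if "b \<in> B" for b
    unfolding s_def by (rule someI_ex) (use B(1) that in blast)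
  obtain f where f: "linear f" "\<And>b. b \<in> B \<Longrightarrow> f b = g (s b)"
    using linear_independent_extend[OF B(2), of "\<lambda>b. g (s b)"] by blast
  have "f (\<tau> x) = g x" if x: "x \<in> X" for x
  proof (rule ccontr)
    assume ne: "f (\<tau> x) \<noteq> g x"
    define d where "d = f (\<tau> x) - g x"
    have "independent {d}" using ne by (simp add: d_def)
    then obtain l :: "'z \<Rightarrow> real" where l: "linear l" "l d = 1"
      using linear_independent_extend[of "{d}" "\<lambda>_. 1::real"] by auto
    obtain L where L: "linear L" "\<forall>x\<in>X. L (\<tau> x) = l (g x)"
      using assms[OF l(1)] by blast
    have "(l \<circ> f) (\<tau> x) = L (\<tau> x)"
    proof (rule linear_eq_on[of "l \<circ> f" L _ B])
      show "linear (l \<circ> f)" by (rule linear_compose[OF f(1) l(1)])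
      show "linear L" by (rule L(1))
      show "\<tau> x \<in> span B" using B(3) x by blast
      fix b assume "b \<in> B"
      then show "(l \<circ> f) b = L b" using f(2) L(2) s by (metis comp_apply)
    qed
    then have "l d = 0"
      using L(2) x linear_diff[OF l(1)] by (simp add: d_def)
    with l(2) show False by simp
  qed
  with f(1) show ?thesis by blast
qed

lemma linear_apply: "linear (\<lambda>T :: _ \<Rightarrow> real. T b)"
  by (rule linearI) simp_all

lemma linear_on_comp: "linear l \<Longrightarrow> linear_on V f \<Longrightarrow> linear_on V (\<lambda>x. l (f x))"
  by (simp add: linear_on_def linear_add linear_scale)

lemma tensor_universal:
  assumes "bilinear_on V W \<beta>"
  shows "\<exists>f. linear f \<and> (\<forall>v\<in>V. \<forall>w\<in>W. f (tensor V W v w) = \<beta> v w)"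
proof -
  have "\<exists>f. linear f \<and> (\<forall>x\<in>V \<times> W. f (case x of (v, w) \<Rightarrow> tensor V W v w) = (case x of (v, w) \<Rightarrow> \<beta> v w))"
  proof (rule factor_through)
    fix l :: "'c \<Rightarrow> real" assume l: "linear l"
    have "bilinear_on V W (\<lambda>v w. l (\<beta> v w))"
      using assms by (auto simp: bilinear_on_def intro!: linear_on_comp[OF l])
    then show "\<exists>L. linear L \<and> (\<forall>x\<in>V \<times> W. L (case x of (v, w) \<Rightarrow> tensor V W v w) = l (case x of (v, w) \<Rightarrow> \<beta> v w))"
      by (intro exI[of _ "\<lambda>T. T (\<lambda>v w. l (\<beta> v w))"]) (auto simp: linear_apply tensor_def)
  qed
  then show ?thesis by auto
qed

lemma tensor_bilinear: "bilinear_on V W (tensor V W)"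
  by (auto simp: bilinear_on_def linear_on_def tensor_def fun_eq_iff)

lemma Sym2_universal:
  assumes "sym_bilinear_on V \<beta>"
  shows "\<exists>f. linear f \<and> (\<forall>u\<in>V. \<forall>v\<in>V. f (sym2_mult V u v) = \<beta> u v)"
proof -
  have "\<exists>f. linear f \<and> (\<forall>x\<in>V \<times> V. f (case x of (v, w) \<Rightarrow> sym2_mult V v w) = (case x of (v, w) \<Rightarrow> \<beta> v w))"
  proof (rule factor_through)
    fix l :: "'b \<Rightarrow> real" assume l: "linear l"
    have "sym_bilinear_on V (\<lambda>v w. l (\<beta> v w))"
      using assms by (auto simp: sym_bilinear_on_def bilinear_on_def intro!: linear_on_comp[OF l])
    then show "\<exists>L. linear L \<and> (\<forall>x\<in>V \<times> V. L (case x of (v, w) \<Rightarrow> sym2_mult V v w) = l (case x of (v, w) \<Rightarrow> \<beta> v w))"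
      by (intro exI[of _ "\<lambda>T. T (\<lambda>v w. l (\<beta> v w))"]) (auto simp: linear_apply sym2_mult_def)
  qed
  then show ?thesis by auto
qed

lemma sym2_mult_sym_bilinear: "sym_bilinear_on V (sym2_mult V)"
  by (auto simp: sym_bilinear_on_def bilinear_on_def linear_on_def sym2_mult_def fun_eq_iff)

lemma multi_tensor_universal:
  assumes "multilinear_on V m"
  shows "\<exists>f. linear f \<and> (\<forall>u. (\<forall>i. u i \<in> V i) \<longrightarrow> f (multi_tensor V u) = m u)"
proof -
  have "\<exists>f. linear f \<and> (\<forall>u\<in>{u. \<forall>i. u i \<in> V i}. f (multi_tensor V u) = m u)"
  proof (rule factor_through)
    fix l :: "'c \<Rightarrow> real" assume l: "linear l"
    have "multilinear_on V (\<lambda>u. l (m u))"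
      using assms by (auto simp: multilinear_on_def intro!: linear_on_comp[OF l])
    then show "\<exists>L. linear L \<and> (\<forall>u\<in>{u. \<forall>i. u i \<in> V i}. L (multi_tensor V u) = l (m u))"
      by (intro exI[of _ "\<lambda>T. T (\<lambda>u. l (m u))"]) (auto simp: linear_apply multi_tensor_def)
  qed
  then show ?thesis by auto
qed

lemma multi_tensor_multilinear: "multilinear_on V (multi_tensor V)"
  by (auto simp: multilinear_on_def linear_on_def multi_tensor_def fun_eq_iff)

lemma sym_power_universal:
  assumes "sym_multilinear_on V m"
  shows "\<exists>f. linear f \<and> (\<forall>u. (\<forall>i. u i \<in> V) \<longrightarrow> f (sym_prod V u) = m u)"
proof -
  have "\<exists>f. linear f \<and> (\<forall>u\<in>{u. \<forall>i. u i \<in> V}. f (sym_prod V u) = m u)"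
  proof (rule factor_through)
    fix l :: "'c \<Rightarrow> real" assume l: "linear l"
    have "sym_multilinear_on V (\<lambda>u. l (m u))"
      using assms by (auto simp: sym_multilinear_on_def multilinear_on_def intro!: linear_on_comp[OF l])
    then show "\<exists>L. linear L \<and> (\<forall>u\<in>{u. \<forall>i. u i \<in> V}. L (sym_prod V u) = l (m u))"
      by (intro exI[of _ "\<lambda>T. T (\<lambda>u. l (m u))"]) (auto simp: linear_apply sym_prod_def)
  qed
  then show ?thesis by auto
qed

lemma sym_prod_sym_multilinear: "sym_multilinear_on V (sym_prod V)"
  by (auto simp: sym_multilinear_on_def multilinear_on_def linear_on_def sym_prod_def fun_eq_iff)

section \<open>The canonical maps on generators\<close>

lemma sym2_pairing_mult:
  assumes "f \<in> dual V" "g \<in> dual V" "u \<in> V" "v \<in> V"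
  shows "sym2_pairing V (sym2_mult (dual V) f g) (sym2_mult V u v) = (f u * g v + f v * g u) / 2"
proof -
  have in_Sym2: "sym2_mult V u v \<in> Sym2 V"
    unfolding Sym2_def using assms by (intro span_base) blast
  have "sym_bilinear_on V (\<lambda>u v. (f u * g v + f v * g u) / 2)"
    if "f \<in> dual V" "g \<in> dual V" for f g :: "'a \<Rightarrow> real"
    using that by (simp add: sym_bilinear_on_def bilinear_on_def linear_on_def dual_def lin_maps_def
        algebra_simps add_divide_distrib)
  then have val: "sym2_mult V u v (\<lambda>u v. (f u * g v + f v * g u) / 2) = (f u * g v + f v * g u) / 2"
    if "f \<in> dual V" "g \<in> dual V" for f g
    using that by (simp add: sym2_mult_def)
  have "f + g \<in> dual V" "c *\<^sub>R f \<in> dual V" if "f \<in> dual V" "g \<in> dual V" for c f g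
    using that by (auto simp: dual_def lin_maps_def linear_on_def algebra_simps)
  then have "sym_bilinear_on (dual V)
      (\<lambda>f g. sym2_mult V u v (\<lambda>u v. (f u * g v + f v * g u) / 2))"
    unfolding sym_bilinear_on_def[of "dual V"] bilinear_on_def[of "dual V"] linear_on_def[of "dual V"]
    by (simp only: val ball_simps cong: ball_cong) (simp add: algebra_simps add_divide_distrib)
  with in_Sym2 assms val show ?thesis
    by (simp add: sym2_pairing_def sym2_mult_def[of "dual V"])
qed

lemma quad_eval_mult: "quad_eval (sym2_mult (dual V) f g) v = f v * g v"
proof -
  have "sym_bilinear_on (dual V) (\<lambda>f g. f v * g v)"
    by (auto simp: sym_bilinear_on_def bilinear_on_def linear_on_def field_simps)
  then show ?thesis by (simp add: quad_eval_def sym2_mult_def)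
qed

section \<open>Powers of squares versus products of squares\<close>

text \<open>The symmetric power of the PSD cone is generated by products of possibly different
  squares.  Powers of single squares, that is the points of the composite of the two Veronese
  maps taken literally, generate a strictly smaller cone in general: on the plane, the symmetric form on
  the symmetric square that sends a pair of squares of \<open>v\<close> and \<open>w\<close> to the square of the determinant of \<open>(v, w)\<close>
  vanishes on the diagonal.\<close>

lemma powers_of_squares_insufficient:
  defines "V \<equiv> UNIV :: (real \<times> real) set"
  shows "convex_cone hull {sym_prod (Sym2 V) (\<lambda>_ :: bool. sq V v) | v. v \<in> V}
    \<noteq> convex_cone hull {sym_prod (Sym2 V) (\<lambda>i :: bool. sq V (v i)) | v. \<forall>i. v i \<in> V}"
proof -
  define a where "a A = A (\<lambda>u v :: real \<times> real. fst u * fst v)" for A :: "(real \<times> real \<Rightarrow> real \<times> real \<Rightarrow> real) \<Rightarrow> real"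
  define b where "b A = A (\<lambda>u v :: real \<times> real. fst u * snd v + snd u * fst v)" for A :: "(real \<times> real \<Rightarrow> real \<times> real \<Rightarrow> real) \<Rightarrow> real"
  define c where "c A = A (\<lambda>u v :: real \<times> real. snd u * snd v)" for A :: "(real \<times> real \<Rightarrow> real \<times> real \<Rightarrow> real) \<Rightarrow> real"
  define m where "m A = a (A False) * c (A True) + c (A False) * a (A True)
    - b (A False) * b (A True) / 2" for A :: "bool \<Rightarrow> (real \<times> real \<Rightarrow> real \<times> real \<Rightarrow> real) \<Rightarrow> real"
  have abc: "a (sq V v) = fst v * fst v" "b (sq V v) = 2 * (fst v * snd v)" "c (sq V v) = snd v * snd v" for v
    unfolding a_def b_def c_def sym2_mult_def sym_bilinear_on_def bilinear_on_def linear_on_def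
    by (auto simp: algebra_simps)
  have lin: "a (x + y) = a x + a y" "b (x + y) = b x + b y" "c (x + y) = c x + c y"
    "a (t *\<^sub>R x) = t * a x" "b (t *\<^sub>R x) = t * b x" "c (t *\<^sub>R x) = t * c x" for x y t
    by (simp_all add: a_def b_def c_def)
  have "multilinear_on (\<lambda>_. Sym2 V) m"
    unfolding multilinear_on_def linear_on_def
    by (simp add: m_def lin all_bool_eq algebra_simps add_divide_distrib)
  moreover have "m (u \<circ> \<pi>) = m u" if "\<pi> permutes UNIV" for u and \<pi> :: "bool \<Rightarrow> bool"
  proof -
    have "\<pi> False \<noteq> \<pi> True" using permutes_inj[OF that] by (auto dest: injD)
    then show ?thesis by (cases "\<pi> False"; cases "\<pi> True") (simp_all add: m_def)
  qed
  ultimately have m: "sym_multilinear_on (Sym2 V) m"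
    by (simp add: sym_multilinear_on_def)
  have zero: "T m = 0" if "T \<in> convex_cone hull {sym_prod (Sym2 V) (\<lambda>_ :: bool. sq V v) | v. v \<in> V}" for T
  proof -
    have "convex_cone {T :: _ \<Rightarrow> real. T m = 0}"
      by (auto simp: convex_cone_iff)
    moreover have "{sym_prod (Sym2 V) (\<lambda>_ :: bool. sq V v) | v. v \<in> V} \<subseteq> {T. T m = 0}"
      by (auto simp: sym_prod_def m m_def abc)
    ultimately show ?thesis using that hull_minimal[of _ "{T. T m = 0}" convex_cone] by blast
  qed
  define e :: "bool \<Rightarrow> real \<times> real" where "e i = (if i then (0, 1) else (1, 0))" for i
  have "sym_prod (Sym2 V) (\<lambda>i. sq V (e i)) m = 1"
    by (simp add: sym_prod_def m m_def abc e_def)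
  moreover have "sym_prod (Sym2 V) (\<lambda>i. sq V (e i))
      \<in> convex_cone hull {sym_prod (Sym2 V) (\<lambda>i :: bool. sq V (v i)) | v. \<forall>i. v i \<in> V}"
    by (intro hull_inc) (auto simp: V_def)
  ultimately show ?thesis using zero by fastforce
qed

end

theory Submission
  imports Defs
begin

text \<open>The theorem has a linear half and a conic half, and each rests on one observation.

Linear half: every pairing in the statement is perfect.  A finite-dimensional pairing of \<open>X\<close> with \<open>Y\<close>
is perfect as soon as there are finite families in \<open>X\<close> and in \<open>Y\<close> such that every vector of either
space expands in its own family, the coefficients being its pairings with the members of the other
(\<open>dual_frames_bij\<close>).  For \<open>V\<close> and its dual, a basis and the dual basis are such families.
Products of members of such families are again such families, for symmetric squares
(\<open>dual_frames_sym2\<close>), for tensor products (\<open>dual_frames_tensor\<close>) and for tensor products of many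
factors (\<open>dual_frames_multi_tensor\<close>), because products are multilinear.

Conic half: a functional is nonnegative on a cone if and only if it is so on generators of the cone.
The PSD cone is generated by squares, so by multilinearity every product of PSD cones is
generated by products of squares, and the value of a functional at a product of squares is
the value of the corresponding polynomial at a point.  Hence the dual cones of tensor products are
the cones of nonnegative polynomials.  The only step that is not multilinear algebra is that
the nonnegative quadratic forms are the sums of squares of linear forms
(\<open>psd_form_sum_of_squares\<close>).  It gives the self-duality of the PSD cone, and with it the
description by homomorphisms: \<open>h\<close> maps PSD elements to PSD elements if and only if the pairing of
\<open>h (v\<^sup>2)\<close> with \<open>w\<^sup>2\<close> is nonnegative for all \<open>v\<close> and \<open>w\<close>.

For the symmetric power, a functional on it is a symmetric multilinear form on the symmetric square of
\<open>V\<close>.  Squares span the symmetric square, so such a form is determined by its values on squares, and a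
multilinear form is symmetric if its values on squares are permutation invariant.\<close>

section \<open>Linear maps on subspaces\<close>

lemma sum_fun_apply: "(\<Sum>i\<in>I. f i) x = (\<Sum>i\<in>I. f i x)"
  for f :: "'i \<Rightarrow> 'x \<Rightarrow> real"
  by (induction I rule: infinite_finite_induct) auto

lemma subspace_fin_dim: "fin_dim V \<Longrightarrow> subspace V"
  by (auto simp: fin_dim_def)

lemma fin_dim_basis:
  assumes "fin_dim V"
  shows "\<exists>B. finite B \<and> independent B \<and> V = span B"
proof -
  obtain S where S: "finite S" "V = span S" using assms by (auto simp: fin_dim_def)
  obtain B where B: "B \<subseteq> S" "independent B" "S \<subseteq> span B"
    using maximal_independent_subset[of S] by blast
  have "V = span B" using B S by (metis span_eq span_superset subset_trans)
  moreover have "finite B" using B S finite_subset by blast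
  ultimately show ?thesis using B(2) by blast
qed

lemma linear_on_0: "linear_on X f \<Longrightarrow> subspace X \<Longrightarrow> f 0 = 0"
  unfolding linear_on_def by (metis scale_zero_left subspace_0)

lemma linear_on_sum:
  assumes "linear_on X f" "subspace X" "\<And>i. i \<in> I \<Longrightarrow> x i \<in> X"
  shows "f (\<Sum>i\<in>I. c i *\<^sub>R x i) = (\<Sum>i\<in>I. c i *\<^sub>R f (x i))"
  using assms(3)
proof (induction I rule: infinite_finite_induct)
  case (insert j I)
  have "c j *\<^sub>R x j \<in> X" "(\<Sum>i\<in>I. c i *\<^sub>R x i) \<in> X"
    using insert.prems assms(2) by (auto intro!: subspace_sum subspace_scale)
  with insert assms(1) show ?case by (simp add: linear_on_def)
qed (use linear_on_0[OF assms(1,2)] in auto)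

lemma linear_on_cong: "subspace X \<Longrightarrow> (\<And>x. x \<in> X \<Longrightarrow> f x = g x) \<Longrightarrow> linear_on X f \<longleftrightarrow> linear_on X g"
  by (simp add: linear_on_def subspace_add subspace_scale)

text \<open>Equality of linear maps is always checked on generators.  The functions are linear only on the
span, so the argument takes place in the subspace where they agree.\<close>

lemma linear_on_eq_on_span:
  assumes f: "linear_on (span G) f" and g: "linear_on (span G) g"
    and eq: "\<And>x. x \<in> G \<Longrightarrow> f x = g x" and x: "x \<in> span G"
  shows "f x = g x"
proof -
  have "subspace {x \<in> span G. f x = g x}"
    using f g linear_on_0[OF f] linear_on_0[OF g]
    by (auto simp: subspace_def linear_on_def span_zero span_add span_scale)
  then have "span G \<subseteq> {x \<in> span G. f x = g x}"
    using eq by (intro span_minimal) (auto simp: span_base)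
  with x show ?thesis by blast
qed

lemma dual_iff: "f \<in> dual V \<longleftrightarrow> linear_on V f \<and> (\<forall>x. x \<notin> V \<longrightarrow> f x = 0)"
  by (auto simp: dual_def lin_maps_def)

text \<open>A functional belongs to \<open>dual Y\<close> only if it vanishes outside \<open>Y\<close>; this cuts off a functional that is
defined on the ambient space.\<close>

lemma restrict_dual:
  "linear_on Y f \<Longrightarrow> subspace Y \<Longrightarrow> (\<lambda>y. if y \<in> Y then f y else 0) \<in> dual Y"
  by (simp add: dual_iff linear_on_def subspace_add subspace_scale)

lemma lin_maps_into: "h \<in> lin_maps X Y \<Longrightarrow> x \<in> X \<Longrightarrow> h x \<in> Y"
  by (auto simp: lin_maps_def)

lemma lin_maps_outside: "h \<in> lin_maps X Y \<Longrightarrow> x \<notin> X \<Longrightarrow> h x = 0"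
  by (simp add: lin_maps_def)

lemma subspace_dual: "subspace (dual V)"
  by (auto simp: subspace_def dual_iff linear_on_def algebra_simps)

lemma dual_eqI:
  assumes "f \<in> dual (span G)" "g \<in> dual (span G)" "\<And>x. x \<in> G \<Longrightarrow> f x = g x"
  shows "f = g"
proof
  fix x show "f x = g x"
    using assms linear_on_eq_on_span[of G f g x] by (cases "x \<in> span G") (auto simp: dual_iff)
qed

section \<open>Multilinear maps and generators\<close>

text \<open>Both the span and the convex cone of a set of generators \<open>G\<close> let a linear map carry a property \<open>K\<close>
of its values from \<open>G\<close> to all of \<open>C\<close>.  With this common form, the passage from linear to multilinear maps
is made once for subspaces and cones together.\<close>

definition propagates ::
    "'a::real_vector set \<Rightarrow> 'a set \<Rightarrow> 'a set \<Rightarrow> 'b::real_vector set \<Rightarrow> bool"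
  where "propagates X G C K \<longleftrightarrow> G \<subseteq> C \<and> C \<subseteq> X \<and>
    (\<forall>f. linear_on X f \<longrightarrow> f ` G \<subseteq> K \<longrightarrow> f ` C \<subseteq> K)"

lemma propagates_span:
  assumes "subspace K"
  shows "propagates (span G) G (span G) K"
  unfolding propagates_def
proof (intro conjI allI impI)
  fix f assume f: "linear_on (span G) f" "f ` G \<subseteq> K"
  have "subspace {x \<in> span G. f x \<in> K}"
    using f assms linear_on_0[OF f(1)]
    by (auto simp: subspace_def linear_on_def span_zero span_add span_scale)
  then have "span G \<subseteq> {x \<in> span G. f x \<in> K}"
    using f(2) by (intro span_minimal) (auto simp: span_base)
  then show "f ` span G \<subseteq> K" by blast
qed (auto simp: span_superset)

lemma linear_on_span_into:
  "linear_on (span G) f \<Longrightarrow> subspace K \<Longrightarrow> f ` G \<subseteq> K \<Longrightarrow> f ` span G \<subseteq> K"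
  using propagates_span[of K G] by (simp add: propagates_def)

lemma propagates_cone:
  assumes "convex_cone K" "subspace X" "G \<subseteq> X"
  shows "propagates X G (convex_cone hull G) K"
  unfolding propagates_def
proof (intro conjI allI impI)
  show "convex_cone hull G \<subseteq> X"
    using assms by (intro hull_minimal) (auto simp: subspace_imp_convex_cone)
  fix f assume f: "linear_on X f" "f ` G \<subseteq> K"
  have "convex_cone {x \<in> X. f x \<in> K}"
    using f assms linear_on_0[OF f(1)]
    by (auto simp: convex_cone_iff linear_on_def subspace_def)
  then have "convex_cone hull G \<subseteq> {x \<in> X. f x \<in> K}"
    using f(2) assms(3) by (intro hull_minimal) auto
  then show "f ` (convex_cone hull G) \<subseteq> K" by blast
qed (auto simp: hull_subset)

lemma propagates_bilinear:
  assumes \<beta>: "bilinear_on X Y \<beta>"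
    and X: "propagates X G C K" and Y: "propagates Y H D K"
    and K: "\<And>u v. u \<in> G \<Longrightarrow> v \<in> H \<Longrightarrow> \<beta> u v \<in> K" and cd: "c \<in> C" "d \<in> D"
  shows "\<beta> c d \<in> K"
proof -
  have "\<beta> u d \<in> K" if "u \<in> G" for u
  proof -
    have "linear_on Y (\<beta> u)" using \<beta> X that by (auto simp: bilinear_on_def propagates_def)
    with Y K[OF that] cd(2) show ?thesis unfolding propagates_def by blast
  qed
  moreover have "linear_on X (\<lambda>u. \<beta> u d)"
    using \<beta> Y cd(2) by (auto simp: bilinear_on_def propagates_def)
  ultimately have "(\<lambda>u. \<beta> u d) ` C \<subseteq> K" using X unfolding propagates_def by blast
  with cd(1) show ?thesis by blast
qed

text \<open>The slots are moved from generators to arbitrary elements one at a time; with the other slots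
fixed, the map is linear in the slot that moves.\<close>

lemma propagates_multilinear:
  fixes X :: "'n::finite \<Rightarrow> 'a::real_vector set"
  assumes m: "multilinear_on X m" and X: "\<And>i. propagates (X i) (G i) (C i) K"
    and K: "\<And>u. (\<And>i. u i \<in> G i) \<Longrightarrow> m u \<in> K" and c: "\<And>i. c i \<in> C i"
  shows "m c \<in> K"
proof -
  have "m c \<in> K" if "\<And>i. c i \<in> (if i \<in> S then C i else G i)" for S c
    using finite[of S] that
  proof (induction S arbitrary: c rule: finite_induct)
    case empty
    then show ?case using K by simp
  next
    case (insert k S)
    have *: "c i \<in> C i" for i
      using insert.prems[of i] X[of i] unfolding propagates_def by (auto split: if_splits)
    have "linear_on (X k) (\<lambda>x. m (c(k := x)))"
      using m * X unfolding multilinear_on_def propagates_def by blast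
    moreover have "m (c(k := x)) \<in> K" if x: "x \<in> G k" for x
    proof (rule insert.IH)
      fix i show "(c(k := x)) i \<in> (if i \<in> S then C i else G i)"
        using insert.prems[of i] x insert.hyps by (auto split: if_splits)
    qed
    ultimately have "(\<lambda>x. m (c(k := x))) ` C k \<subseteq> K"
      using X[of k] unfolding propagates_def by blast
    moreover have "m (c(k := c k)) \<in> (\<lambda>x. m (c(k := x))) ` C k"
      using *[of k] by (rule imageI)
    ultimately show ?case by auto
  qed
  from this[of _ UNIV] show ?thesis using c by simp
qed

lemma multilinear_onD:
  "multilinear_on X m \<Longrightarrow> (\<And>i. u i \<in> X i) \<Longrightarrow> linear_on (X k) (\<lambda>x. m (u(k := x)))"
  by (simp add: multilinear_on_def)

lemma sym_multilinear_onD: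
  "sym_multilinear_on X m \<Longrightarrow> \<pi> permutes UNIV \<Longrightarrow> (\<And>i. x i \<in> X) \<Longrightarrow> m (x \<circ> \<pi>) = m x"
  by (simp add: sym_multilinear_on_def)

lemma sym_prod_multilinear: "multilinear_on (\<lambda>_. X) (sym_prod X)"
  by (rule sym_prod_sym_multilinear[unfolded sym_multilinear_on_def, THEN conjunct1])

text \<open>A multilinear map of linear combinations is the sum over all ways to choose one term in each slot.
The slots are expanded one after another.\<close>

lemma multilinear_expansion:
  fixes X :: "'n::finite \<Rightarrow> 'a::real_vector set" and m :: "('n \<Rightarrow> 'a) \<Rightarrow> 'b::real_vector"
  assumes m: "multilinear_on X m" and X: "\<And>i. subspace (X i)"
    and x: "\<And>i j. j \<in> J i \<Longrightarrow> x i j \<in> X i" and J: "\<And>i. finite (J i)"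
  shows "m (\<lambda>i. \<Sum>j\<in>J i. a i j *\<^sub>R x i j) =
    (\<Sum>j\<in>PiE UNIV J. (\<Prod>i\<in>UNIV. a i (j i)) *\<^sub>R m (\<lambda>i. x i (j i)))"
proof -
  define y where "y i = (\<Sum>j\<in>J i. a i j *\<^sub>R x i j)" for i
  have y: "y i \<in> X i" for i
    unfolding y_def using x X by (intro subspace_sum subspace_scale) auto
  have "m y = (\<Sum>j\<in>PiE S J. (\<Prod>i\<in>S. a i (j i)) *\<^sub>R m (\<lambda>i. if i \<in> S then x i (j i) else y i))" for S
    using finite[of S]
  proof (induction S rule: finite_induct)
    case (insert k S)
    let ?z = "\<lambda>S j i. if i \<in> S then x i (j i) else y i"
    have slot: "m (?z S j) = (\<Sum>l\<in>J k. a k l *\<^sub>R m (?z (insert k S) (j(k := l))))"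
      if j: "j \<in> PiE S J" for j
    proof -
      have z: "?z S j i \<in> X i" for i using j x y by (auto simp: PiE_def Pi_def)
      have "linear_on (X k) (\<lambda>v. m ((?z S j)(k := v)))"
        by (rule multilinear_onD[OF m z])
      from linear_on_sum[OF this X, of "J k" "x k" "a k"]
      have "m ((?z S j)(k := y k)) = (\<Sum>l\<in>J k. a k l *\<^sub>R m ((?z S j)(k := x k l)))"
        using x by (simp add: y_def)
      moreover have "(?z S j)(k := y k) = ?z S j" using insert.hyps by auto
      moreover have "(?z S j)(k := x k l) = ?z (insert k S) (j(k := l))" for l
        using insert.hyps by auto
      ultimately show ?thesis by simp
    qed
    have pr: "(\<Prod>i\<in>insert k S. a i ((j(k := l)) i)) = a k l * (\<Prod>i\<in>S. a i (j i))" for j l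
      using insert.hyps by (auto intro!: prod.cong)
    have "(\<Sum>j\<in>PiE (insert k S) J. (\<Prod>i\<in>insert k S. a i (j i)) *\<^sub>R m (?z (insert k S) j))
      = (\<Sum>(l, j)\<in>J k \<times> PiE S J. (\<Prod>i\<in>insert k S. a i ((j(k := l)) i)) *\<^sub>R m (?z (insert k S) (j(k := l))))"
      unfolding PiE_insert_eq
      by (subst sum.reindex[OF inj_combinator[OF insert.hyps(2)]]) (simp add: case_prod_unfold)
    also have "\<dots> = (\<Sum>j\<in>PiE S J. \<Sum>l\<in>J k. (a k l * (\<Prod>i\<in>S. a i (j i))) *\<^sub>R m (?z (insert k S) (j(k := l))))"
      unfolding pr by (subst sum.cartesian_product[symmetric]) (rule sum.swap)
    also have "\<dots> = (\<Sum>j\<in>PiE S J. (\<Prod>i\<in>S. a i (j i)) *\<^sub>R m (?z S j))"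
      by (intro sum.cong refl) (simp add: slot scaleR_sum_right mult.commute)
    finally show ?case using insert.IH by simp
  qed simp
  from this[of UNIV] show ?thesis by (simp add: y_def[abs_def])
qed

lemma bilinear_on_expand:
  assumes bil: "bilinear_on X Y \<beta>" and X: "subspace X" and Y: "subspace Y"
    and x: "\<And>i. i \<in> I \<Longrightarrow> x i \<in> X" and y: "\<And>j. j \<in> J \<Longrightarrow> y j \<in> Y"
  shows "\<beta> (\<Sum>i\<in>I. a i *\<^sub>R x i) (\<Sum>j\<in>J. b j *\<^sub>R y j) =
    (\<Sum>(i,j)\<in>I \<times> J. (a i * b j) *\<^sub>R \<beta> (x i) (y j))"
proof -
  have s: "(\<Sum>j\<in>J. b j *\<^sub>R y j) \<in> Y"
    using y Y by (intro subspace_sum subspace_scale)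
  have "\<beta> (\<Sum>i\<in>I. a i *\<^sub>R x i) (\<Sum>j\<in>J. b j *\<^sub>R y j) =
    (\<Sum>i\<in>I. a i *\<^sub>R \<beta> (x i) (\<Sum>j\<in>J. b j *\<^sub>R y j))"
    using bil s by (intro linear_on_sum[OF _ X x]) (auto simp: bilinear_on_def)
  also have "\<dots> = (\<Sum>i\<in>I. a i *\<^sub>R (\<Sum>j\<in>J. b j *\<^sub>R \<beta> (x i) (y j)))"
    using bil x by (intro sum.cong refl arg_cong2[of _ _ _ _ scaleR] linear_on_sum[OF _ Y y])
      (auto simp: bilinear_on_def)
  finally show ?thesis
    by (simp add: scaleR_sum_right sum.cartesian_product)
qed

section \<open>Perfect pairings\<close>

text \<open>Families that resolve the identities of \<open>X\<close> and \<open>Y\<close> through the pairing \<open>\<Phi>\<close>.  When \<open>\<Phi>\<close> evaluates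
functionals on \<open>V\<close> at vectors of \<open>V\<close>, a basis with its dual basis is an example.  This form of perfectness is chosen
because it passes to products by mere expansion.\<close>

definition dual_frames ::
    "('x::real_vector \<Rightarrow> 'y::real_vector \<Rightarrow> real) \<Rightarrow> 'x set \<Rightarrow> 'y set
      \<Rightarrow> 'i set \<Rightarrow> ('i \<Rightarrow> 'x) \<Rightarrow> ('i \<Rightarrow> 'y) \<Rightarrow> bool"
  where "dual_frames \<Phi> X Y I x y \<longleftrightarrow> finite I \<and> x ` I \<subseteq> X \<and> y ` I \<subseteq> Y \<and>
    (\<forall>p\<in>X. p = (\<Sum>i\<in>I. \<Phi> p (y i) *\<^sub>R x i)) \<and> (\<forall>q\<in>Y. q = (\<Sum>i\<in>I. \<Phi> (x i) q *\<^sub>R y i))"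

lemma dual_framesD:
  assumes "dual_frames \<Phi> X Y I x y"
  shows "finite I" "i \<in> I \<Longrightarrow> x i \<in> X" "i \<in> I \<Longrightarrow> y i \<in> Y"
    "p \<in> X \<Longrightarrow> (\<Sum>i\<in>I. \<Phi> p (y i) *\<^sub>R x i) = p"
    "q \<in> Y \<Longrightarrow> (\<Sum>i\<in>I. \<Phi> (x i) q *\<^sub>R y i) = q"
  using assms by (auto simp: dual_frames_def)

text \<open>An element of \<open>X\<close> is recovered from its pairings with the family in \<open>Y\<close>, hence injectivity.  A
functional \<open>\<phi>\<close> comes from the combination of the family in \<open>X\<close> with the coefficients \<open>\<phi> (y i)\<close>.\<close>

lemma dual_frames_bij:
  assumes fr: "dual_frames \<Phi> X Y I x y" and lin: "linear_on X \<Phi>" and X: "subspace X"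
    and Y: "subspace Y" and into: "\<Phi> ` X \<subseteq> dual Y"
  shows "bij_betw \<Phi> X (dual Y)"
  unfolding bij_betw_def
proof
  show "inj_on \<Phi> X"
    using fr unfolding inj_on_def dual_frames_def by metis
  have "\<phi> \<in> \<Phi> ` X" if \<phi>: "\<phi> \<in> dual Y" for \<phi>
  proof -
    define p where "p = (\<Sum>i\<in>I. \<phi> (y i) *\<^sub>R x i)"
    have p: "p \<in> X" unfolding p_def
      using fr X by (auto simp: dual_frames_def intro!: subspace_sum subspace_scale)
    have "\<Phi> p = (\<Sum>i\<in>I. \<phi> (y i) *\<^sub>R \<Phi> (x i))"
      unfolding p_def using fr by (intro linear_on_sum[OF lin X]) (auto simp: dual_frames_def)
    then have \<Phi>p: "\<Phi> p q = (\<Sum>i\<in>I. \<phi> (y i) * \<Phi> (x i) q)" for q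
      by (simp add: sum_fun_apply)
    have "\<Phi> p q = \<phi> q" for q
    proof (cases "q \<in> Y")
      case True
      then have "\<phi> q = \<phi> (\<Sum>i\<in>I. \<Phi> (x i) q *\<^sub>R y i)" using fr by (simp add: dual_frames_def)
      also have "\<dots> = (\<Sum>i\<in>I. \<Phi> (x i) q *\<^sub>R \<phi> (y i))"
        using \<phi> fr by (intro linear_on_sum[OF _ Y]) (auto simp: dual_iff dual_frames_def)
      finally show ?thesis by (simp add: \<Phi>p mult.commute)
    next
      case False
      then show ?thesis using \<phi> p into by (auto simp: dual_iff)
    qed
    then have "\<Phi> p = \<phi>" by (rule ext)
    then show ?thesis using p by blast
  qed
  with into show "\<Phi> ` X = dual Y" by blast
qed

text \<open>Both sides of an expansion depend linearly on the vector that is expanded, so it is enough to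
expand generators.\<close>

lemma dual_frames_spanI:
  assumes lin: "linear_on X \<Phi>" and into: "\<Phi> ` X \<subseteq> dual Y" and I: "finite I"
    and X: "X = span G" and Y: "Y = span H"
    and x: "\<And>i. i \<in> I \<Longrightarrow> x i \<in> X" and y: "\<And>i. i \<in> I \<Longrightarrow> y i \<in> Y"
    and G: "\<And>p. p \<in> G \<Longrightarrow> p = (\<Sum>i\<in>I. \<Phi> p (y i) *\<^sub>R x i)"
    and H: "\<And>q. q \<in> H \<Longrightarrow> q = (\<Sum>i\<in>I. \<Phi> (x i) q *\<^sub>R y i)"
  shows "dual_frames \<Phi> X Y I x y"
proof -
  have "linear_on (span G) (\<lambda>p. \<Sum>i\<in>I. \<Phi> p (y i) *\<^sub>R x i)"
    using lin by (simp add: linear_on_def X scaleR_left_distrib sum.distrib scaleR_sum_right)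
  moreover have "linear_on (span H) (\<lambda>q. \<Sum>i\<in>I. \<Phi> (x i) q *\<^sub>R y i)"
  proof -
    have "linear_on (span H) (\<Phi> (x i))" if "i \<in> I" for i
      using x[OF that] into by (auto simp: dual_iff Y)
    then show ?thesis
      by (simp add: linear_on_def scaleR_left_distrib sum.distrib scaleR_sum_right)
  qed
  moreover have "linear_on Z (\<lambda>p. p)" for Z by (simp add: linear_on_def)
  ultimately have "p = (\<Sum>i\<in>I. \<Phi> p (y i) *\<^sub>R x i)" "q = (\<Sum>i\<in>I. \<Phi> (x i) q *\<^sub>R y i)"
    if "p \<in> X" "q \<in> Y" for p q
    using linear_on_eq_on_span[of G "\<lambda>p. p" "\<lambda>p. \<Sum>i\<in>I. \<Phi> p (y i) *\<^sub>R x i" p]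
      linear_on_eq_on_span[of H "\<lambda>q. q" "\<lambda>q. \<Sum>i\<in>I. \<Phi> (x i) q *\<^sub>R y i" q] that G H
    unfolding X Y by blast+
  moreover have "0 \<in> X" "0 \<in> Y" by (auto simp: X Y span_zero)
  ultimately show ?thesis
    unfolding dual_frames_def using I x y by blast
qed

lemma dual_frames_dual:
  fixes V :: "'a::real_vector set"
  assumes "fin_dim V"
  shows "\<exists>B (f :: 'a \<Rightarrow> 'a \<Rightarrow> real) v. dual_frames (\<lambda>f v. f v) (dual V) V B f v"
proof -
  obtain B where finB: "finite B" and B: "independent B" and VB: "V = span B"
    using fin_dim_basis[OF assms] by blast
  define f where "f b x = (if x \<in> V then representation B x b else 0)" for b x
  have f: "f b \<in> dual V" for b
    using B by (auto simp: dual_iff linear_on_def f_def VB span_add span_scale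
      representation_add representation_scale)
  have res: "v = (\<Sum>b\<in>B. f b v *\<^sub>R b)" if "v \<in> V" for v
    using that B finB by (simp add: f_def VB sum_representation_eq)
  have "g = (\<Sum>b\<in>B. g b *\<^sub>R f b)" if g: "g \<in> dual V" for g
  proof
    fix v
    show "g v = (\<Sum>b\<in>B. g b *\<^sub>R f b) v"
    proof (cases "v \<in> V")
      case True
      have "g (\<Sum>b\<in>B. f b v *\<^sub>R b) = (\<Sum>b\<in>B. f b v *\<^sub>R g b)"
        using g by (intro linear_on_sum[where X = V]) (auto simp: dual_iff VB span_base)
      then show ?thesis using res[OF True] by (simp add: sum_fun_apply mult.commute)
    next
      case False
      then show ?thesis using g by (simp add: dual_iff sum_fun_apply f_def)
    qed
  qed
  then have "dual_frames (\<lambda>f v. f v) (dual V) V B f (\<lambda>b. b)"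
    using finB f res unfolding dual_frames_def by (auto simp: VB span_base)
  then show ?thesis by blast
qed

section \<open>The pairing of symmetric squares\<close>

lemma sym2_mult_in: "u \<in> V \<Longrightarrow> v \<in> V \<Longrightarrow> sym2_mult V u v \<in> Sym2 V"
  unfolding Sym2_def by (rule span_base) blast

lemma sym2_mult_bilinear: "bilinear_on V V (sym2_mult V)"
  using sym2_mult_sym_bilinear[of V] by (simp add: sym_bilinear_on_def)

lemma sym2_mult_commute: "u \<in> V \<Longrightarrow> v \<in> V \<Longrightarrow> sym2_mult V u v = sym2_mult V v u"
  using sym2_mult_sym_bilinear[of V] by (simp add: sym_bilinear_on_def)

lemma symmetrized_product_form: "f \<in> dual V \<Longrightarrow> g \<in> dual V \<Longrightarrow>
    sym_bilinear_on V (\<lambda>u v. (f u * g v + f v * g u) / 2)"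
  by (simp add: sym_bilinear_on_def bilinear_on_def linear_on_def dual_def lin_maps_def
        algebra_simps add_divide_distrib)

text \<open>An element of \<open>Sym2 (dual V)\<close> takes meaningful values on symmetric bilinear forms only.  This says that the
argument it receives in the definition of \<open>sym2_pairing\<close> is such a form.\<close>

lemma sym2_apply_form:
  assumes A: "A \<in> Sym2 V"
  shows "sym_bilinear_on (dual V) (\<lambda>f g. A (\<lambda>u v. (f u * g v + f v * g u) / 2))"
proof -
  let ?P = "\<lambda>A. sym_bilinear_on (dual V) (\<lambda>f g. A (\<lambda>u v. (f u * g v + f v * g u) / 2))"
  have lin: "?P 0" "\<And>A B. ?P A \<Longrightarrow> ?P B \<Longrightarrow> ?P (A + B)" "\<And>c A. ?P A \<Longrightarrow> ?P (c *\<^sub>R A)"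
    by (simp_all add: sym_bilinear_on_def bilinear_on_def linear_on_def algebra_simps)
  have gen: "?P (sym2_mult V u v)" if "u \<in> V" "v \<in> V" for u v
  proof -
    have val: "sym2_mult V u v (\<lambda>u v. (f u * g v + f v * g u) / 2) = (f u * g v + f v * g u) / 2"
      if "f \<in> dual V" "g \<in> dual V" for f g
      using symmetrized_product_form[OF that] by (simp add: sym2_mult_def)
    show ?thesis
      unfolding sym_bilinear_on_def bilinear_on_def linear_on_def
      by (simp only: val subspace_add[OF subspace_dual] subspace_scale[OF subspace_dual]
          ball_simps cong: ball_cong)
        (simp add: algebra_simps add_divide_distrib)
  qed
  have "subspace {A. ?P A}" using lin by (auto simp: subspace_def)
  then have "Sym2 V \<subseteq> {A. ?P A}"
    unfolding Sym2_def using gen by (intro span_minimal) auto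
  with A show ?thesis by blast
qed

lemma linear_on_sym2_pairing: "linear_on X (sym2_pairing V)"
  by (auto simp: linear_on_def sym2_pairing_def fun_eq_iff)

lemma sym2_pairing_dual: "P \<in> Sym2 (dual V) \<Longrightarrow> sym2_pairing V P \<in> dual (Sym2 V)"
proof -
  have "sym2_pairing V ` Sym2 (dual V) \<subseteq> dual (Sym2 V)"
    unfolding Sym2_def[of "dual V"]
  proof (rule linear_on_span_into[OF linear_on_sym2_pairing subspace_dual], safe)
    fix f g assume fg: "f \<in> dual V" "g \<in> dual V"
    have "sym2_pairing V (sym2_mult (dual V) f g) A = A (\<lambda>u v. (f u * g v + f v * g u) / 2)"
      if "A \<in> Sym2 V" for A
      using sym2_apply_form[OF that] that by (simp add: sym2_pairing_def sym2_mult_def)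
    then show "sym2_pairing V (sym2_mult (dual V) f g) \<in> dual (Sym2 V)"
      by (simp add: dual_iff linear_on_def Sym2_def span_add span_scale)
        (simp add: sym2_pairing_def Sym2_def)
  qed
  then show "P \<in> Sym2 (dual V) \<Longrightarrow> sym2_pairing V P \<in> dual (Sym2 V)" by blast
qed

lemma sym2_pairing_linear:
  assumes "P \<in> Sym2 (dual V)"
  shows "linear_on (Sym2 V) (sym2_pairing V P)"
  using sym2_pairing_dual[OF assms] by (simp add: dual_iff)

text \<open>Expanding both factors of \<open>g h\<close> gives the coefficients \<open>g(v\<^sub>i) h(v\<^sub>j)\<close>, while the pairing gives
their symmetrisation.  The two agree because \<open>g h = h g\<close>: the average of the two expansions is the one
that is wanted.\<close>

lemma dual_frames_sym2:
  assumes fr: "dual_frames (\<lambda>f v. f v) (dual V) V I f v" and V: "subspace V"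
  shows "dual_frames (sym2_pairing V) (Sym2 (dual V)) (Sym2 V) (I \<times> I)
    (\<lambda>(i,j). sym2_mult (dual V) (f i) (f j)) (\<lambda>(i,j). sym2_mult V (v i) (v j))"
proof -
  have I: "finite I" and f: "\<And>i. i \<in> I \<Longrightarrow> f i \<in> dual V" and v: "\<And>i. i \<in> I \<Longrightarrow> v i \<in> V"
    and ef: "\<And>g. g \<in> dual V \<Longrightarrow> (\<Sum>i\<in>I. g (v i) *\<^sub>R f i) = g"
    and ev: "\<And>u. u \<in> V \<Longrightarrow> (\<Sum>i\<in>I. f i u *\<^sub>R v i) = u"
    using dual_framesD[OF fr] by auto
  show ?thesis
  proof (rule dual_frames_spanI[OF linear_on_sym2_pairing _ _ Sym2_def Sym2_def])
    fix p assume "p \<in> {sym2_mult (dual V) g h |g h. g \<in> dual V \<and> h \<in> dual V}"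
    then obtain g h where p: "p = sym2_mult (dual V) g h" and gh: "g \<in> dual V" "h \<in> dual V"
      by blast
    have 1: "p = (\<Sum>(i,j)\<in>I \<times> I. (g (v i) * h (v j)) *\<^sub>R sym2_mult (dual V) (f i) (f j))"
      using bilinear_on_expand[where I = I and J = I and a = "\<lambda>i. g (v i)" and b = "\<lambda>i. h (v i)" and x = f and y = f, OF sym2_mult_bilinear subspace_dual subspace_dual f f] gh
      by (simp add: p ef)
    have 2: "p = (\<Sum>(i,j)\<in>I \<times> I. (h (v i) * g (v j)) *\<^sub>R sym2_mult (dual V) (f i) (f j))"
      using bilinear_on_expand[where I = I and J = I and a = "\<lambda>i. h (v i)" and b = "\<lambda>i. g (v i)" and x = f and y = f, OF sym2_mult_bilinear subspace_dual subspace_dual f f] gh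
      by (simp add: p ef sym2_mult_commute[of g "dual V" h])
    have "p = (1/2) *\<^sub>R p + (1/2) *\<^sub>R p" by (simp add: scaleR_left_distrib[symmetric])
    also have "\<dots> = (1/2) *\<^sub>R (\<Sum>(i,j)\<in>I \<times> I. (g (v i) * h (v j)) *\<^sub>R sym2_mult (dual V) (f i) (f j)) +
        (1/2) *\<^sub>R (\<Sum>(i,j)\<in>I \<times> I. (h (v i) * g (v j)) *\<^sub>R sym2_mult (dual V) (f i) (f j))"
      by (simp only: 1[symmetric] 2[symmetric])
    also have "\<dots> = (\<Sum>(i,j)\<in>I \<times> I. ((g (v i) * h (v j) + g (v j) * h (v i)) / 2) *\<^sub>R sym2_mult (dual V) (f i) (f j))"
      by (simp add: scaleR_sum_right sum.distrib[symmetric] case_prod_unfold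
          scaleR_left_distrib[symmetric] add_divide_distrib mult.commute)
    also have "\<dots> = (\<Sum>i\<in>I \<times> I. sym2_pairing V p (case i of (i,j) \<Rightarrow> sym2_mult V (v i) (v j)) *\<^sub>R
        (case i of (i,j) \<Rightarrow> sym2_mult (dual V) (f i) (f j)))"
      using gh v by (intro sum.cong refl) (auto simp: p sym2_pairing_mult)
    finally show "p = \<dots>" .
  next
    fix q assume "q \<in> {sym2_mult V u w |u w. u \<in> V \<and> w \<in> V}"
    then obtain u w where q: "q = sym2_mult V u w" and uw: "u \<in> V" "w \<in> V"
      by blast
    have 1: "q = (\<Sum>(i,j)\<in>I \<times> I. (f i u * f j w) *\<^sub>R sym2_mult V (v i) (v j))"
      using bilinear_on_expand[where I = I and J = I and a = "\<lambda>i. f i u" and b = "\<lambda>i. f i w" and x = v and y = v, OF sym2_mult_bilinear V V v v] uw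
      by (simp add: q ev)
    have 2: "q = (\<Sum>(i,j)\<in>I \<times> I. (f i w * f j u) *\<^sub>R sym2_mult V (v i) (v j))"
      using bilinear_on_expand[where I = I and J = I and a = "\<lambda>i. f i w" and b = "\<lambda>i. f i u" and x = v and y = v, OF sym2_mult_bilinear V V v v] uw
      by (simp add: q ev sym2_mult_commute[of u V w])
    have "q = (1/2) *\<^sub>R q + (1/2) *\<^sub>R q" by (simp add: scaleR_left_distrib[symmetric])
    also have "\<dots> = (1/2) *\<^sub>R (\<Sum>(i,j)\<in>I \<times> I. (f i u * f j w) *\<^sub>R sym2_mult V (v i) (v j)) +
        (1/2) *\<^sub>R (\<Sum>(i,j)\<in>I \<times> I. (f i w * f j u) *\<^sub>R sym2_mult V (v i) (v j))"
      by (simp only: 1[symmetric] 2[symmetric])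
    also have "\<dots> = (\<Sum>(i,j)\<in>I \<times> I. ((f i u * f j w + f i w * f j u) / 2) *\<^sub>R sym2_mult V (v i) (v j))"
      by (simp add: scaleR_sum_right sum.distrib[symmetric] case_prod_unfold
          scaleR_left_distrib[symmetric] add_divide_distrib mult.commute)
    also have "\<dots> = (\<Sum>i\<in>I \<times> I. sym2_pairing V (case i of (i,j) \<Rightarrow> sym2_mult (dual V) (f i) (f j)) q *\<^sub>R
        (case i of (i,j) \<Rightarrow> sym2_mult V (v i) (v j)))"
      using uw f by (intro sum.cong refl) (auto simp: q sym2_pairing_mult)
    finally show "q = \<dots>" .
  qed (use I f v sym2_pairing_dual in \<open>auto intro!: sym2_mult_in\<close>)
qed

lemma Sym2_frames:
  fixes V :: "'a::real_vector set"
  assumes "fin_dim V"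
  shows "\<exists>(I :: ('a \<times> 'a) set) p A. dual_frames (sym2_pairing V) (Sym2 (dual V)) (Sym2 V) I p A"
  using dual_frames_dual[OF assms] dual_frames_sym2[OF _ subspace_fin_dim[OF assms]] by blast

lemma subspace_Sym2: "subspace (Sym2 V)"
  by (simp add: Sym2_def)

lemma sym2_pairing_bij:
  assumes "fin_dim V"
  shows "bij_betw (sym2_pairing V) (Sym2 (dual V)) (dual (Sym2 V))"
  using Sym2_frames[OF assms] dual_frames_bij[OF _ linear_on_sym2_pairing subspace_Sym2 subspace_Sym2]
    sym2_pairing_dual by blast

lemma sym2_pairing_eqI:
  assumes V: "fin_dim V" and P: "P \<in> Sym2 (dual V)" and R: "R \<in> Sym2 (dual V)"
    and eq: "\<And>A. A \<in> Sym2 V \<Longrightarrow> sym2_pairing V P A = sym2_pairing V R A"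
  shows "P = R"
proof -
  have "sym2_pairing V P = sym2_pairing V R"
  proof
    show "sym2_pairing V P A = sym2_pairing V R A" for A
      by (cases "A \<in> Sym2 V") (simp add: eq, simp add: sym2_pairing_def)
  qed
  then show ?thesis
    using inj_onD[OF bij_betw_imp_inj_on[OF sym2_pairing_bij[OF V]] _ P R] by blast
qed

section \<open>The pairings of tensor products\<close>

lemma subspace_tensor_space: "subspace (tensor_space X Y)"
  by (simp add: tensor_space_def)

lemma tensor_in: "x \<in> X \<Longrightarrow> y \<in> Y \<Longrightarrow> tensor X Y x y \<in> tensor_space X Y"
  unfolding tensor_space_def by (rule span_base) blast

lemma bilinear_on_cong:
  assumes "subspace X" "subspace Y" "\<And>x y. x \<in> X \<Longrightarrow> y \<in> Y \<Longrightarrow> \<beta> x y = \<gamma> x y"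
  shows "bilinear_on X Y \<beta> \<longleftrightarrow> bilinear_on X Y \<gamma>"
  using assms linear_on_cong[of X "\<lambda>x. \<beta> x y" "\<lambda>x. \<gamma> x y" for y]
    linear_on_cong[of Y "\<beta> x" "\<gamma> x" for x]
  by (auto simp: bilinear_on_def)

lemma bilinear_on_product:
  assumes "linear_on X f" "linear_on Y g"
  shows "bilinear_on X Y (\<lambda>x y. f x * g y :: real)"
  using assms by (auto simp: bilinear_on_def linear_on_def algebra_simps)

lemma tensor_product_form:
  "P \<in> Sym2 (dual V) \<Longrightarrow> R \<in> Sym2 (dual W) \<Longrightarrow>
    bilinear_on (Sym2 V) (Sym2 W) (\<lambda>A B. sym2_pairing V P A * sym2_pairing W R B)"
  by (intro bilinear_on_product sym2_pairing_linear)

text \<open>As for symmetric squares, the argument that is inserted in the definition of \<open>tensor_pairing\<close> is a bilinear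
form, so the pairing with a product \<open>P \<otimes> R\<close> is given by the formula that defines it.\<close>

lemma tensor_apply_form:
  assumes T: "T \<in> tensor_space (Sym2 V) (Sym2 W)"
  shows "bilinear_on (Sym2 (dual V)) (Sym2 (dual W))
    (\<lambda>P R. T (\<lambda>A B. sym2_pairing V P A * sym2_pairing W R B))" (is "?P T")
proof -
  have lin: "?P 0" "\<And>A B. ?P A \<Longrightarrow> ?P B \<Longrightarrow> ?P (A + B)" "\<And>c A. ?P A \<Longrightarrow> ?P (c *\<^sub>R A)"
    by (simp_all add: bilinear_on_def linear_on_def algebra_simps)
  have gen: "?P (tensor (Sym2 V) (Sym2 W) A B)" if "A \<in> Sym2 V" "B \<in> Sym2 W" for A B
  proof -
    have "bilinear_on (Sym2 (dual V)) (Sym2 (dual W)) (\<lambda>P R. sym2_pairing V P A * sym2_pairing W R B)"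
      by (intro bilinear_on_product) (auto simp: linear_on_def sym2_pairing_def)
    then show ?thesis
      by (subst bilinear_on_cong[OF subspace_Sym2 subspace_Sym2]) (auto simp: tensor_def tensor_product_form)
  qed
  have "subspace {T. ?P T}" using lin by (auto simp: subspace_def)
  then have "tensor_space (Sym2 V) (Sym2 W) \<subseteq> {T. ?P T}"
    unfolding tensor_space_def using gen by (intro span_minimal) auto
  with T show ?thesis by blast
qed

lemma linear_on_tensor_pairing: "linear_on X (tensor_pairing V W)"
  by (auto simp: linear_on_def tensor_pairing_def fun_eq_iff)

lemma tensor_pairing_tensor:
  assumes "P \<in> Sym2 (dual V)" "R \<in> Sym2 (dual W)" "T \<in> tensor_space (Sym2 V) (Sym2 W)"
  shows "tensor_pairing V W (tensor (Sym2 (dual V)) (Sym2 (dual W)) P R) T =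
    T (\<lambda>A B. sym2_pairing V P A * sym2_pairing W R B)"
  using assms tensor_apply_form[OF assms(3)] by (simp add: tensor_pairing_def tensor_def)

lemma tensor_pairing_tensor_tensor:
  assumes "P \<in> Sym2 (dual V)" "R \<in> Sym2 (dual W)" "A \<in> Sym2 V" "B \<in> Sym2 W"
  shows "tensor_pairing V W (tensor (Sym2 (dual V)) (Sym2 (dual W)) P R) (tensor (Sym2 V) (Sym2 W) A B) =
    sym2_pairing V P A * sym2_pairing W R B"
  using assms tensor_pairing_tensor[OF assms(1,2) tensor_in[OF assms(3,4)]]
  by (simp add: tensor_def tensor_product_form)

lemma tensor_pairing_dual:
  "tensor_pairing V W ` biquad_polys V W \<subseteq> dual (tensor_space (Sym2 V) (Sym2 W))"
  unfolding tensor_space_def[of "Sym2 (dual V)"]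
proof (rule linear_on_span_into[OF linear_on_tensor_pairing subspace_dual], safe)
  fix P R assume PR: "P \<in> Sym2 (dual V)" "R \<in> Sym2 (dual W)"
  show "tensor_pairing V W (tensor (Sym2 (dual V)) (Sym2 (dual W)) P R) \<in> dual (tensor_space (Sym2 V) (Sym2 W))"
    unfolding dual_iff linear_on_def
    using tensor_pairing_tensor[OF PR]
    by (auto simp: subspace_add[OF subspace_tensor_space] subspace_scale[OF subspace_tensor_space])
      (simp add: tensor_pairing_def)
qed

lemma dual_frames_tensor:
  assumes I: "dual_frames (sym2_pairing V) (Sym2 (dual V)) (Sym2 V) I p A"
    and J: "dual_frames (sym2_pairing W) (Sym2 (dual W)) (Sym2 W) J r B"
  shows "dual_frames (tensor_pairing V W) (biquad_polys V W) (tensor_space (Sym2 V) (Sym2 W)) (I \<times> J)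
    (\<lambda>(i,j). tensor (Sym2 (dual V)) (Sym2 (dual W)) (p i) (r j))
    (\<lambda>(i,j). tensor (Sym2 V) (Sym2 W) (A i) (B j))"
proof -
  have fin: "finite I" "finite J" and p: "\<And>i. i \<in> I \<Longrightarrow> p i \<in> Sym2 (dual V)"
    and r: "\<And>j. j \<in> J \<Longrightarrow> r j \<in> Sym2 (dual W)" and A: "\<And>i. i \<in> I \<Longrightarrow> A i \<in> Sym2 V"
    and B: "\<And>j. j \<in> J \<Longrightarrow> B j \<in> Sym2 W"
    and eP: "\<And>P. P \<in> Sym2 (dual V) \<Longrightarrow> (\<Sum>i\<in>I. sym2_pairing V P (A i) *\<^sub>R p i) = P"
    and eA: "\<And>C. C \<in> Sym2 V \<Longrightarrow> (\<Sum>i\<in>I. sym2_pairing V (p i) C *\<^sub>R A i) = C"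
    and eR: "\<And>R. R \<in> Sym2 (dual W) \<Longrightarrow> (\<Sum>j\<in>J. sym2_pairing W R (B j) *\<^sub>R r j) = R"
    and eB: "\<And>D. D \<in> Sym2 W \<Longrightarrow> (\<Sum>j\<in>J. sym2_pairing W (r j) D *\<^sub>R B j) = D"
    using dual_framesD[OF I] dual_framesD[OF J] by auto
  show ?thesis
  proof (rule dual_frames_spanI[OF linear_on_tensor_pairing tensor_pairing_dual _ tensor_space_def tensor_space_def])
    fix Q assume "Q \<in> {tensor (Sym2 (dual V)) (Sym2 (dual W)) P R |P R. P \<in> Sym2 (dual V) \<and> R \<in> Sym2 (dual W)}"
    then obtain P R where Q: "Q = tensor (Sym2 (dual V)) (Sym2 (dual W)) P R"
      and PR: "P \<in> Sym2 (dual V)" "R \<in> Sym2 (dual W)" by blast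
    have "Q = (\<Sum>(i,j)\<in>I \<times> J. (sym2_pairing V P (A i) * sym2_pairing W R (B j)) *\<^sub>R
        tensor (Sym2 (dual V)) (Sym2 (dual W)) (p i) (r j))"
      using bilinear_on_expand[where I = I and J = J and a = "\<lambda>i. sym2_pairing V P (A i)" and b = "\<lambda>j. sym2_pairing W R (B j)" and x = p and y = r, OF tensor_bilinear subspace_Sym2 subspace_Sym2 p r]
      by (simp add: eP[OF PR(1)] eR[OF PR(2)] Q)
    also have "\<dots> = (\<Sum>k\<in>I \<times> J. tensor_pairing V W Q (case k of (i,j) \<Rightarrow> tensor (Sym2 V) (Sym2 W) (A i) (B j)) *\<^sub>R
        (case k of (i,j) \<Rightarrow> tensor (Sym2 (dual V)) (Sym2 (dual W)) (p i) (r j)))"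
      using PR A B by (intro sum.cong refl) (auto simp: Q tensor_pairing_tensor_tensor)
    finally show "Q = \<dots>" .
  next
    fix T assume "T \<in> {tensor (Sym2 V) (Sym2 W) C D |C D. C \<in> Sym2 V \<and> D \<in> Sym2 W}"
    then obtain C D where T: "T = tensor (Sym2 V) (Sym2 W) C D"
      and CD: "C \<in> Sym2 V" "D \<in> Sym2 W" by blast
    have "T = (\<Sum>(i,j)\<in>I \<times> J. (sym2_pairing V (p i) C * sym2_pairing W (r j) D) *\<^sub>R
        tensor (Sym2 V) (Sym2 W) (A i) (B j))"
      using bilinear_on_expand[where I = I and J = J and a = "\<lambda>i. sym2_pairing V (p i) C" and b = "\<lambda>j. sym2_pairing W (r j) D" and x = A and y = B, OF tensor_bilinear subspace_Sym2 subspace_Sym2 A B]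
      by (simp add: eA[OF CD(1)] eB[OF CD(2)] T)
    also have "\<dots> = (\<Sum>k\<in>I \<times> J. tensor_pairing V W (case k of (i,j) \<Rightarrow> tensor (Sym2 (dual V)) (Sym2 (dual W)) (p i) (r j)) T *\<^sub>R
        (case k of (i,j) \<Rightarrow> tensor (Sym2 V) (Sym2 W) (A i) (B j)))"
      using CD p r by (intro sum.cong refl) (auto simp: T tensor_pairing_tensor_tensor)
    finally show "T = \<dots>" .
  qed (use fin p r A B in \<open>auto intro!: tensor_in\<close>)
qed

lemma tensor_pairing_bij:
  assumes "fin_dim V" "fin_dim W"
  shows "bij_betw (tensor_pairing V W) (biquad_polys V W) (dual (tensor_space (Sym2 V) (Sym2 W)))"
proof -
  obtain I p A J r B where "dual_frames (sym2_pairing V) (Sym2 (dual V)) (Sym2 V) (I :: ('a \<times> 'a) set) p A"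
    "dual_frames (sym2_pairing W) (Sym2 (dual W)) (Sym2 W) (J :: ('b \<times> 'b) set) r B"
    using Sym2_frames assms by meson
  from dual_frames_bij[OF dual_frames_tensor[OF this] linear_on_tensor_pairing subspace_tensor_space
      subspace_tensor_space tensor_pairing_dual] show ?thesis .
qed

lemma multi_tensor_in: "(\<And>i. x i \<in> X i) \<Longrightarrow> multi_tensor X x \<in> multi_tensor_space X"
  unfolding multi_tensor_space_def by (rule span_base) blast

lemma subspace_multi_tensor_space: "subspace (multi_tensor_space X)"
  by (simp add: multi_tensor_space_def)

lemma multilinear_on_cong:
  assumes X: "\<And>i. subspace (X i)" and eq: "\<And>x. (\<And>i. x i \<in> X i) \<Longrightarrow> m x = m' x"
  shows "multilinear_on X m \<longleftrightarrow> multilinear_on X m'"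
proof -
  have "linear_on (X k) (\<lambda>y. m (x(k := y))) \<longleftrightarrow> linear_on (X k) (\<lambda>y. m' (x(k := y)))"
    if "\<forall>i. x i \<in> X i" for x k
    using that by (intro linear_on_cong X eq) auto
  then show ?thesis by (simp add: multilinear_on_def)
qed

lemma multilinear_on_prod:
  assumes "\<And>i. linear_on (X i) (f i)"
  shows "multilinear_on X (\<lambda>x. \<Prod>i\<in>UNIV. f i (x i) :: real)"
proof -
  have "(\<Prod>i\<in>UNIV. f i ((x(k := y)) i)) = (\<Prod>i\<in>UNIV - {k}. f i (x i)) * f k y" for x k y
    by (subst prod.remove[of _ k]) (auto intro!: prod.cong)
  then show ?thesis using assms
    by (simp add: multilinear_on_def linear_on_def algebra_simps)
qed

lemma multi_product_form:
  "(\<And>i. P i \<in> Sym2 (dual (V i))) \<Longrightarrow>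
    multilinear_on (\<lambda>i. Sym2 (V i)) (\<lambda>A. \<Prod>i\<in>UNIV. sym2_pairing (V i) (P i) (A i))"
  by (intro multilinear_on_prod sym2_pairing_linear)

lemma multi_tensor_apply_form:
  assumes T: "T \<in> multi_tensor_space (\<lambda>i. Sym2 (V i))"
  shows "multilinear_on (\<lambda>i. Sym2 (dual (V i)))
    (\<lambda>P. T (\<lambda>A. \<Prod>i\<in>UNIV. sym2_pairing (V i) (P i) (A i)))" (is "?P T")
proof -
  have lin: "?P 0" "\<And>A B. ?P A \<Longrightarrow> ?P B \<Longrightarrow> ?P (A + B)" "\<And>c A. ?P A \<Longrightarrow> ?P (c *\<^sub>R A)"
    by (simp_all add: multilinear_on_def linear_on_def algebra_simps)
  have gen: "?P (multi_tensor (\<lambda>i. Sym2 (V i)) A)" if "\<forall>i. A i \<in> Sym2 (V i)" for A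
  proof -
    have "multilinear_on (\<lambda>i. Sym2 (dual (V i))) (\<lambda>P. \<Prod>i\<in>UNIV. sym2_pairing (V i) (P i) (A i))"
      by (intro multilinear_on_prod) (auto simp: linear_on_def sym2_pairing_def)
    then show ?thesis
      by (subst multilinear_on_cong[OF subspace_Sym2]) (auto simp: multi_tensor_def multi_product_form)
  qed
  have "subspace {T. ?P T}" using lin by (auto simp: subspace_def)
  then have "multi_tensor_space (\<lambda>i. Sym2 (V i)) \<subseteq> {T. ?P T}"
    unfolding multi_tensor_space_def using gen by (intro span_minimal) auto
  with T show ?thesis by blast
qed

lemma linear_on_multi_tensor_pairing: "linear_on X (multi_tensor_pairing V)"
  by (auto simp: linear_on_def multi_tensor_pairing_def fun_eq_iff)

lemma multi_tensor_pairing_multi_tensor: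
  assumes "\<And>i. P i \<in> Sym2 (dual (V i))" "T \<in> multi_tensor_space (\<lambda>i. Sym2 (V i))"
  shows "multi_tensor_pairing V (multi_tensor (\<lambda>i. Sym2 (dual (V i))) P) T =
    T (\<lambda>A. \<Prod>i\<in>UNIV. sym2_pairing (V i) (P i) (A i))"
  using assms multi_tensor_apply_form[OF assms(2)] by (simp add: multi_tensor_pairing_def multi_tensor_def)

lemma multi_tensor_pairing_multi_tensor_multi_tensor:
  assumes "\<And>i. P i \<in> Sym2 (dual (V i))" "\<And>i. A i \<in> Sym2 (V i)"
  shows "multi_tensor_pairing V (multi_tensor (\<lambda>i. Sym2 (dual (V i))) P) (multi_tensor (\<lambda>i. Sym2 (V i)) A) =
    (\<Prod>i\<in>UNIV. sym2_pairing (V i) (P i) (A i))"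
  using assms multi_tensor_pairing_multi_tensor[OF assms(1) multi_tensor_in[of A, OF assms(2)]]
  by (simp add: multi_tensor_def multi_product_form)

lemma multi_tensor_pairing_dual:
  "multi_tensor_pairing V ` multiquad_polys V \<subseteq> dual (multi_tensor_space (\<lambda>i. Sym2 (V i)))"
  unfolding multi_tensor_space_def[of "\<lambda>i. Sym2 (dual (V i))"]
proof (rule linear_on_span_into[OF linear_on_multi_tensor_pairing subspace_dual], safe)
  fix P assume P: "\<forall>i. P i \<in> Sym2 (dual (V i))"
  show "multi_tensor_pairing V (multi_tensor (\<lambda>i. Sym2 (dual (V i))) P) \<in> dual (multi_tensor_space (\<lambda>i. Sym2 (V i)))"
    unfolding dual_iff linear_on_def
    using multi_tensor_pairing_multi_tensor[of P, OF P[rule_format]]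
    by (auto simp: subspace_add[OF subspace_multi_tensor_space] subspace_scale[OF subspace_multi_tensor_space])
      (simp add: multi_tensor_pairing_def)
qed

lemma dual_frames_multi_tensor:
  assumes fr: "\<And>i. dual_frames (sym2_pairing (V i)) (Sym2 (dual (V i))) (Sym2 (V i)) (J i) (p i) (A i)"
  shows "dual_frames (multi_tensor_pairing V) (multiquad_polys V) (multi_tensor_space (\<lambda>i. Sym2 (V i)))
    (PiE UNIV J) (\<lambda>j. multi_tensor (\<lambda>i. Sym2 (dual (V i))) (\<lambda>i. p i (j i)))
    (\<lambda>j. multi_tensor (\<lambda>i. Sym2 (V i)) (\<lambda>i. A i (j i)))"
proof -
  have fin: "\<And>i. finite (J i)" and p: "\<And>i j. j \<in> J i \<Longrightarrow> p i j \<in> Sym2 (dual (V i))"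
    and A: "\<And>i j. j \<in> J i \<Longrightarrow> A i j \<in> Sym2 (V i)"
    and eP: "\<And>i P. P \<in> Sym2 (dual (V i)) \<Longrightarrow> (\<Sum>j\<in>J i. sym2_pairing (V i) P (A i j) *\<^sub>R p i j) = P"
    and eA: "\<And>i C. C \<in> Sym2 (V i) \<Longrightarrow> (\<Sum>j\<in>J i. sym2_pairing (V i) (p i j) C *\<^sub>R A i j) = C"
    using dual_framesD[OF fr] by auto
  have mem: "j i \<in> J i" if "j \<in> PiE UNIV J" for i j using that by auto
  show ?thesis
  proof (rule dual_frames_spanI[OF linear_on_multi_tensor_pairing multi_tensor_pairing_dual _
        multi_tensor_space_def multi_tensor_space_def])
    fix Q assume "Q \<in> {multi_tensor (\<lambda>i. Sym2 (dual (V i))) P |P. \<forall>i. P i \<in> Sym2 (dual (V i))}"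
    then obtain P where Q: "Q = multi_tensor (\<lambda>i. Sym2 (dual (V i))) P"
      and P: "\<And>i. P i \<in> Sym2 (dual (V i))" by blast
    have "Q = (\<Sum>j\<in>PiE UNIV J. (\<Prod>i\<in>UNIV. sym2_pairing (V i) (P i) (A i (j i))) *\<^sub>R
        multi_tensor (\<lambda>i. Sym2 (dual (V i))) (\<lambda>i. p i (j i)))"
      using multilinear_expansion[OF multi_tensor_multilinear subspace_Sym2, of J p,
          OF p fin, of "\<lambda>i j. sym2_pairing (V i) (P i) (A i j)"]
      by (simp add: eP[OF P] Q)
    also have "\<dots> = (\<Sum>j\<in>PiE UNIV J.
        multi_tensor_pairing V Q (multi_tensor (\<lambda>i. Sym2 (V i)) (\<lambda>i. A i (j i))) *\<^sub>R
        multi_tensor (\<lambda>i. Sym2 (dual (V i))) (\<lambda>i. p i (j i)))"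
      unfolding Q using A
      by (intro sum.cong refl, subst multi_tensor_pairing_multi_tensor_multi_tensor[of P, OF P])
        (use mem in auto)
    finally show "Q = \<dots>" .
  next
    fix T assume "T \<in> {multi_tensor (\<lambda>i. Sym2 (V i)) C |C. \<forall>i. C i \<in> Sym2 (V i)}"
    then obtain C where T: "T = multi_tensor (\<lambda>i. Sym2 (V i)) C"
      and C: "\<And>i. C i \<in> Sym2 (V i)" by blast
    have "T = (\<Sum>j\<in>PiE UNIV J. (\<Prod>i\<in>UNIV. sym2_pairing (V i) (p i (j i)) (C i)) *\<^sub>R
        multi_tensor (\<lambda>i. Sym2 (V i)) (\<lambda>i. A i (j i)))"
      using multilinear_expansion[OF multi_tensor_multilinear subspace_Sym2, of J A,
          OF A fin, of "\<lambda>i j. sym2_pairing (V i) (p i j) (C i)"]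
      by (simp add: eA[OF C] T)
    also have "\<dots> = (\<Sum>j\<in>PiE UNIV J.
        multi_tensor_pairing V (multi_tensor (\<lambda>i. Sym2 (dual (V i))) (\<lambda>i. p i (j i))) T *\<^sub>R
        multi_tensor (\<lambda>i. Sym2 (V i)) (\<lambda>i. A i (j i)))"
      unfolding T using p
      by (intro sum.cong refl, subst multi_tensor_pairing_multi_tensor_multi_tensor[of _ V C, OF _ C])
        (use mem in auto)
    finally show "T = \<dots>" .
  qed (use fin p A mem in \<open>auto intro!: multi_tensor_in finite_PiE\<close>)
qed

lemma multi_tensor_pairing_bij:
  fixes V :: "'n::finite \<Rightarrow> 'a::real_vector set"
  assumes "\<And>i. fin_dim (V i)"
  shows "bij_betw (multi_tensor_pairing V) (multiquad_polys V) (dual (multi_tensor_space (\<lambda>i. Sym2 (V i))))"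
proof -
  have "\<forall>i. \<exists>(J :: ('a \<times> 'a) set) p A. dual_frames (sym2_pairing (V i)) (Sym2 (dual (V i))) (Sym2 (V i)) J p A"
    using Sym2_frames assms by blast
  then obtain J :: "'n \<Rightarrow> ('a \<times> 'a) set" and p A where
    fr: "\<And>i. dual_frames (sym2_pairing (V i)) (Sym2 (dual (V i))) (Sym2 (V i)) (J i) (p i) (A i)"
    by metis
  from dual_frames_bij[OF dual_frames_multi_tensor[OF fr] linear_on_multi_tensor_pairing
      subspace_multi_tensor_space subspace_multi_tensor_space multi_tensor_pairing_dual] show ?thesis .
qed

section \<open>Positive semidefinite forms are sums of squares\<close>

lemma psd_form_expand:
  fixes \<beta> :: "'a::real_vector \<Rightarrow> 'a \<Rightarrow> real"
  assumes \<beta>: "sym_bilinear_on V \<beta>" and V: "subspace V" and uv: "u \<in> V" "v \<in> V"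
  shows "\<beta> (u + t *\<^sub>R v) (u + t *\<^sub>R v) = \<beta> u u + 2 * t * \<beta> v u + t\<^sup>2 * \<beta> v v"
proof -
  have *: "u + t *\<^sub>R v \<in> V" "t *\<^sub>R v \<in> V" using uv V by (auto simp: subspace_add subspace_scale)
  have "\<beta> (u + t *\<^sub>R v) (u + t *\<^sub>R v) = \<beta> u (u + t *\<^sub>R v) + t * \<beta> v (u + t *\<^sub>R v)"
    using \<beta> uv * by (simp add: sym_bilinear_on_def bilinear_on_def linear_on_def algebra_simps)
  also have "\<dots> = \<beta> u u + t * \<beta> u v + t * (\<beta> v u + t * \<beta> v v)"
    using \<beta> uv * by (simp add: sym_bilinear_on_def bilinear_on_def linear_on_def algebra_simps)
  also have "\<beta> u v = \<beta> v u" using \<beta> uv by (simp add: sym_bilinear_on_def)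
  finally show ?thesis by (simp add: algebra_simps power2_eq_square)
qed

text \<open>The Cauchy-Schwarz inequality for a form that may be degenerate: the quadratic polynomial
\<open>t \<mapsto> \<beta>(u + t v, u + t v)\<close> is nonnegative.\<close>

lemma psd_form_cauchy_schwarz:
  fixes \<beta> :: "'a::real_vector \<Rightarrow> 'a \<Rightarrow> real"
  assumes \<beta>: "sym_bilinear_on V \<beta>" and V: "subspace V" and pos: "\<And>v. v \<in> V \<Longrightarrow> 0 \<le> \<beta> v v"
    and uv: "u \<in> V" "v \<in> V"
  shows "(\<beta> v u)\<^sup>2 \<le> \<beta> u u * \<beta> v v"
proof -
  have q: "0 \<le> \<beta> u u + 2 * t * \<beta> v u + t\<^sup>2 * \<beta> v v" for t
    using psd_form_expand[OF \<beta> V uv] pos[of "u + t *\<^sub>R v"] V uv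
    by (simp add: subspace_add subspace_scale)
  show ?thesis
  proof (cases "\<beta> v v = 0")
    case True
    have "\<beta> v u = 0"
    proof (rule ccontr)
      assume "\<beta> v u \<noteq> 0"
      \<comment> \<open>At this \<open>t\<close> the linear term is \<open>-(\<beta> u u + 1)\<close>, so the polynomial takes the value \<open>-1\<close>.\<close>
      then show False using q[of "- (\<beta> u u + 1) / (2 * \<beta> v u)"] True by (simp add: field_simps)
    qed
    with True show ?thesis by simp
  next
    case False
    then have p: "\<beta> v v > 0" using pos[OF uv(2)] by simp
    \<comment> \<open>The minimum of the polynomial is at \<open>t = - \<beta> v u / \<beta> v v\<close>.\<close>
    have "0 \<le> \<beta> u u - (\<beta> v u)\<^sup>2 / \<beta> v v"
      using q[of "- \<beta> v u / \<beta> v v"] p by (simp add: power2_eq_square field_simps)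
    with p show ?thesis by (simp add: field_simps)
  qed
qed

text \<open>Completing squares.  If \<open>\<beta>(b,b) > 0\<close>, then subtracting the square of the functional \<open>\<beta>(b,\<cdot>) / sqrt (\<beta>(b,b))\<close>
leaves a form that is still positive semidefinite, by the Cauchy-Schwarz inequality, and has
\<open>b\<close> in its radical.  If \<open>\<beta>(b,b) = 0\<close>, then \<open>b\<close> is in the radical already.  The induction runs over
the set \<open>S\<close> of those spanning vectors that need not yet be in the radical.\<close>

lemma psd_form_sum_of_squares:
  fixes \<beta> :: "'a::real_vector \<Rightarrow> 'a \<Rightarrow> real"
  assumes V: "fin_dim V" and \<beta>: "sym_bilinear_on V \<beta>" and pos: "\<And>v. v \<in> V \<Longrightarrow> 0 \<le> \<beta> v v"
  shows "\<exists>(m::nat) f. (\<forall>k<m. f k \<in> dual V) \<and> (\<forall>u\<in>V. \<forall>v\<in>V. \<beta> u v = (\<Sum>k<m. f k u * f k v))"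
proof -
  obtain B where B: "finite B" "V = span B" using V by (auto simp: fin_dim_def)
  have subV: "subspace V" by (simp add: B)
  have "\<exists>(m::nat) f. (\<forall>k<m. f k \<in> dual V) \<and> (\<forall>u\<in>V. \<forall>v\<in>V. \<beta> u v = (\<Sum>k<m. f k u * f k v))"
    if "finite S" "sym_bilinear_on V \<beta>" "\<And>v. v \<in> V \<Longrightarrow> 0 \<le> \<beta> v v"
      "\<And>b v. b \<in> B - S \<Longrightarrow> v \<in> V \<Longrightarrow> \<beta> b v = 0" for S and \<beta> :: "'a \<Rightarrow> 'a \<Rightarrow> real"
    using that
  proof (induction S arbitrary: \<beta> rule: finite_induct)
    case empty
    have "\<beta> u v = 0" if "u \<in> V" "v \<in> V" for u v
    proof -
      have "linear_on (span B) (\<lambda>u. \<beta> u v)"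
        using empty.prems(1) that B by (simp add: sym_bilinear_on_def bilinear_on_def)
      then have "(\<lambda>u. \<beta> u v) ` span B \<subseteq> {0}"
        by (rule linear_on_span_into) (use empty.prems(3) that in \<open>auto simp: subspace_def\<close>)
      with that B show ?thesis by blast
    qed
    then show ?case by (intro exI[of _ 0]) auto
  next
    case (insert b S)
    have cs: "(\<beta> v u)\<^sup>2 \<le> \<beta> u u * \<beta> v v" if "u \<in> V" "v \<in> V" for u v
      by (rule psd_form_cauchy_schwarz[OF insert.prems(1) subV _ that]) (rule insert.prems(2))
    consider "b \<notin> B" | "b \<in> B" "\<beta> b b = 0" | "b \<in> B" "\<beta> b b \<noteq> 0" by blast
    then show ?case
    proof cases
      case 1
      then have "B - S = B - insert b S" by blast
      with insert show ?thesis by simp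
    next
      case 2
      then have bV: "b \<in> V" by (simp add: B span_base)
      have "\<beta> b v = 0" if "v \<in> V" for v using cs[OF that bV] 2 by simp
      with insert.prems show ?thesis by (intro insert.IH) auto
    next
      case 3
      then have bV: "b \<in> V" by (simp add: B span_base)
      then have p: "\<beta> b b > 0" using 3 insert.prems(2) by force
      define g where "g v = (if v \<in> V then \<beta> b v / sqrt (\<beta> b b) else 0)" for v
      have lin: "linear_on V (\<beta> u)" "linear_on V (\<lambda>v. \<beta> v u)" "\<beta> u v = \<beta> v u" if "u \<in> V" "v \<in> V" for u v
        using insert.prems(1) that by (auto simp: sym_bilinear_on_def bilinear_on_def)
      have g: "g \<in> dual V"
        using lin(1)[OF bV bV] subV
        by (auto simp: dual_iff linear_on_def g_def subspace_add subspace_scale add_divide_distrib)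
      have gg: "g u * g v = \<beta> b u * \<beta> b v / \<beta> b b" if "u \<in> V" "v \<in> V" for u v
        using that p by (simp add: g_def)
      define \<gamma> where "\<gamma> u v = \<beta> u v - g u * g v" for u v
      have "\<exists>(m::nat) f. (\<forall>k<m. f k \<in> dual V) \<and> (\<forall>u\<in>V. \<forall>v\<in>V. \<gamma> u v = (\<Sum>k<m. f k u * f k v))"
      proof (rule insert.IH)
        show "sym_bilinear_on V \<gamma>"
          using insert.prems(1) g
          by (auto simp: sym_bilinear_on_def bilinear_on_def linear_on_def dual_iff \<gamma>_def algebra_simps)
        show "0 \<le> \<gamma> v v" if "v \<in> V" for v
          using cs[OF that bV] p by (simp add: \<gamma>_def gg that field_simps power2_eq_square)
        show "\<gamma> c v = 0" if c: "c \<in> B - S" and v: "v \<in> V" for c v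
        proof (cases "c = b")
          case True
          then show ?thesis using p bV v by (simp add: \<gamma>_def gg)
        next
          case False
          have cV: "c \<in> V" using c by (simp add: B span_base)
          have "\<beta> c v = 0" "\<beta> c b = 0" using insert.prems(3)[of c] c False v bV by auto
          then show ?thesis using lin(3)[OF bV cV] gg[OF cV v] by (simp add: \<gamma>_def)
        qed
      qed
      then obtain m :: nat and f where f: "\<And>k. k < m \<Longrightarrow> f k \<in> dual V"
        and \<gamma>: "\<And>u v. u \<in> V \<Longrightarrow> v \<in> V \<Longrightarrow> \<gamma> u v = (\<Sum>k<m. f k u * f k v)" by blast
      have "\<beta> u v = (\<Sum>k<Suc m. (f(m := g)) k u * (f(m := g)) k v)" if "u \<in> V" "v \<in> V" for u v
        using \<gamma>[OF that] by (simp add: \<gamma>_def)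
      moreover have "(f(m := g)) k \<in> dual V" if "k < Suc m" for k
        using f g that by (auto simp: less_Suc_eq)
      ultimately show ?thesis by blast
    qed
  qed
  from this[of B] B(1) \<beta> pos show ?thesis by blast
qed

section \<open>The PSD cone and cones generated by products of squares\<close>

lemma sq_scale: "v \<in> V \<Longrightarrow> subspace V \<Longrightarrow> sq V (c *\<^sub>R v) = c\<^sup>2 *\<^sub>R sq V v"
  using sym2_mult_bilinear[of V] by (auto simp: bilinear_on_def linear_on_def subspace_scale power2_eq_square)

lemma psd_eq_hull:
  assumes V: "subspace V"
  shows "psd V = convex_cone hull (sq V ` V)"
proof
  have sum: "(\<Sum>k<m. sq V (u k)) \<in> convex_cone hull (sq V ` V)" if "\<forall>k<m. u k \<in> V" for m :: nat and u
    using that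
  proof (induction m)
    case 0
    show ?case by (simp only: lessThan_0 sum.empty convex_cone_hull_contains_0)
  next
    case (Suc m)
    then have "(\<Sum>k<m. sq V (u k)) \<in> convex_cone hull (sq V ` V)"
      "sq V (u m) \<in> convex_cone hull (sq V ` V)" by (auto intro: hull_inc)
    then show ?case unfolding sum.lessThan_Suc by (rule convex_cone_hull_add)
  qed
  then show "psd V \<subseteq> convex_cone hull (sq V ` V)" by (auto simp: psd_def)
  have "0 \<in> psd V" unfolding psd_def by (rule CollectI, rule exI[of _ 0]) simp
  moreover have "x + y \<in> psd V" if xy: "x \<in> psd V" "y \<in> psd V" for x y
  proof -
    obtain m n :: nat and u w where x: "x = (\<Sum>k<m. sq V (u k))" "\<forall>k<m. u k \<in> V"
      and y: "y = (\<Sum>k<n. sq V (w k))" "\<forall>k<n. w k \<in> V"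
      using xy unfolding psd_def by blast
    let ?z = "\<lambda>k. if k < m then u k else w (k - m)"
    have "(\<Sum>k<m + l. h k) = (\<Sum>k<m. h k) + (\<Sum>k<l. h (m + k))" for l and h :: "nat \<Rightarrow> 'a sym2"
      by (induction l) (simp_all add: add.assoc)
    then have "x + y = (\<Sum>k<m + n. sq V (?z k))" by (simp add: x y)
    moreover have "\<forall>k<m + n. ?z k \<in> V" using x y by auto
    ultimately show ?thesis
      unfolding psd_def by (intro CollectI exI[of _ "m + n"] exI[of _ ?z] conjI)
  qed
  moreover have "c *\<^sub>R x \<in> psd V" if x: "x \<in> psd V" and c: "0 \<le> c" for c x
  proof -
    obtain m :: nat and u where x: "x = (\<Sum>k<m. sq V (u k))" "\<forall>k<m. u k \<in> V"
      using x unfolding psd_def by blast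
    \<comment> \<open>A nonnegative factor is absorbed into the squares through its square root.\<close>
    have "c *\<^sub>R x = (\<Sum>k<m. sq V (sqrt c *\<^sub>R u k))"
      using x V c by (simp add: sq_scale scaleR_sum_right)
    moreover have "\<forall>k<m. sqrt c *\<^sub>R u k \<in> V" using x V by (simp add: subspace_scale)
    ultimately show ?thesis
      unfolding psd_def by (intro CollectI exI[of _ m] exI[of _ "\<lambda>k. sqrt c *\<^sub>R u k"] conjI)
  qed
  ultimately have "convex_cone (psd V)" by (auto simp: convex_cone_iff)
  moreover have "sq V v \<in> psd V" if "v \<in> V" for v
    unfolding psd_def using that by (intro CollectI exI[of _ "Suc 0"] exI[of _ "\<lambda>_. v"]) auto
  ultimately show "convex_cone hull (sq V ` V) \<subseteq> psd V" by (intro hull_minimal) auto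
qed

text \<open>Polarisation.\<close>

lemma Sym2_eq_span_squares:
  assumes V: "subspace V"
  shows "Sym2 V = span (sq V ` V)"
proof
  show "span (sq V ` V) \<subseteq> Sym2 V"
    unfolding Sym2_def by (intro span_mono) auto
  have "sym2_mult V u v \<in> span (sq V ` V)" if uv: "u \<in> V" "v \<in> V" for u v
  proof -
    have "sq V (u + v) = sq V u + sq V v + 2 *\<^sub>R sym2_mult V u v"
      using sym2_mult_bilinear[of V] sym2_mult_commute[OF uv] uv V
      by (simp add: bilinear_on_def linear_on_def subspace_add scaleR_2)
    then have "sym2_mult V u v = (1/2) *\<^sub>R (sq V (u + v) - sq V u - sq V v)" by simp
    also have "\<dots> \<in> span (sq V ` V)"
      using uv V by (intro span_scale span_diff span_base) (auto simp: subspace_add)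
    finally show ?thesis .
  qed
  then show "Sym2 V \<subseteq> span (sq V ` V)"
    unfolding Sym2_def by (intro span_minimal) auto
qed

lemma span_convex_cone_hull: "span (convex_cone hull G) = span G"
proof
  have "convex_cone hull G \<subseteq> span G"
    by (intro hull_minimal convex_cone_span span_superset)
  then show "span (convex_cone hull G) \<subseteq> span G" by (intro span_minimal) auto
qed (intro span_mono hull_subset)

lemma span_psd: "subspace V \<Longrightarrow> span (psd V) = Sym2 V"
  by (simp add: psd_eq_hull span_convex_cone_hull Sym2_eq_span_squares)

lemma propagates_psd:
  assumes V: "subspace V" and K: "convex_cone K"
  shows "propagates (Sym2 V) (sq V ` V) (psd V) K"
  unfolding psd_eq_hull[OF V] by (intro propagates_cone K subspace_Sym2) (auto intro: sym2_mult_in)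

lemma propagates_Sym2:
  assumes V: "subspace V" and K: "subspace K"
  shows "propagates (Sym2 V) (sq V ` V) (Sym2 V) K"
  unfolding Sym2_eq_span_squares[OF V] by (rule propagates_span[OF K])

lemma sq_in_Sym2: "v \<in> V \<Longrightarrow> sq V v \<in> Sym2 V"
  by (rule sym2_mult_in)

lemma sq_in_psd: "subspace V \<Longrightarrow> v \<in> V \<Longrightarrow> sq V v \<in> psd V"
  by (simp add: psd_eq_hull hull_inc)

lemma convex_cone_nonneg: "convex_cone {0::real..}"
  by (auto simp: convex_cone_iff)

text \<open>Nonnegativity on generators suffices, since the nonnegative reals are a convex cone.\<close>

lemma dual_cone_hull:
  "dual_cone (convex_cone hull G) = {\<phi> \<in> dual (span G). \<forall>g\<in>G. 0 \<le> \<phi> g}"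
proof -
  have "\<forall>c\<in>convex_cone hull G. 0 \<le> \<phi> c" if \<phi>: "\<phi> \<in> dual (span G)" "\<forall>g\<in>G. 0 \<le> \<phi> g" for \<phi>
  proof -
    have "linear_on (span G) \<phi>" "\<phi> ` G \<subseteq> {0..}" using \<phi> by (auto simp: dual_iff)
    then have "\<phi> ` (convex_cone hull G) \<subseteq> {0..}"
      using propagates_cone[OF convex_cone_nonneg subspace_span span_superset, of G]
      unfolding propagates_def by blast
    then show ?thesis by auto
  qed
  then show ?thesis by (auto simp: dual_cone_def span_convex_cone_hull hull_inc)
qed

lemma identifies_restrict:
  assumes "linear_on X \<Phi>" "bij_betw \<Phi> X Y"
  shows "identifies \<Phi> X {p \<in> X. P (\<Phi> p)} Y {q \<in> Y. P q}"
  using assms by (auto simp: identifies_def bij_betw_def)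

text \<open>The form in which the two halves of the argument are combined: a perfect pairing identifies the dual
of a cone with the elements whose pairings with the generators of the cone are nonnegative.\<close>

lemma identifies_dual_coneI:
  assumes lin: "linear_on X \<Phi>" and bij: "bij_betw \<Phi> X (dual Y)"
    and C: "C = convex_cone hull G" and Y: "Y = span G"
    and K: "K = {p \<in> X. \<forall>g\<in>G. 0 \<le> \<Phi> p g}"
  shows "identifies \<Phi> X K (dual Y) (dual_cone C)"
  unfolding K C dual_cone_hull Y[symmetric] using lin bij by (rule identifies_restrict)

text \<open>A product of two sums of squares expands into a sum of products of squares.  The same expansion,
with linear combinations in place of sums, shows that products of squares span the product spaces, and it applies
to any number of factors and to symmetric powers.\<close>

lemma tensor_cone_psd:
  assumes V: "subspace V" and W: "subspace W"
  shows "tensor_cone (psd V) (psd W) =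
      convex_cone hull {tensor (Sym2 V) (Sym2 W) (sq V v) (sq W w) | v w. v \<in> V \<and> w \<in> W}"
    (is "_ = convex_cone hull ?G")
proof
  have "tensor (Sym2 V) (Sym2 W) c d \<in> convex_cone hull ?G" if "c \<in> psd V" "d \<in> psd W" for c d
  proof (rule propagates_bilinear[OF tensor_bilinear propagates_psd[OF V] propagates_psd[OF W] _ that])
    show "tensor (Sym2 V) (Sym2 W) u x \<in> convex_cone hull ?G" if "u \<in> sq V ` V" "x \<in> sq W ` W" for u x
      using that by (blast intro: hull_inc)
  qed (rule convex_cone_convex_cone_hull)+
  then show "tensor_cone (psd V) (psd W) \<subseteq> convex_cone hull ?G"
    unfolding tensor_cone_def span_psd[OF V] span_psd[OF W]
    by (intro hull_minimal convex_cone_convex_cone_hull) blast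
  show "convex_cone hull ?G \<subseteq> tensor_cone (psd V) (psd W)"
    unfolding tensor_cone_def span_psd[OF V] span_psd[OF W]
    by (intro hull_mono Collect_mono) (use sq_in_psd[OF V] sq_in_psd[OF W] in blast)
qed

lemma tensor_space_Sym2:
  assumes V: "subspace V" and W: "subspace W"
  shows "tensor_space (Sym2 V) (Sym2 W) =
      span {tensor (Sym2 V) (Sym2 W) (sq V v) (sq W w) | v w. v \<in> V \<and> w \<in> W}"
    (is "_ = span ?G")
proof
  have "tensor (Sym2 V) (Sym2 W) c d \<in> span ?G" if "c \<in> Sym2 V" "d \<in> Sym2 W" for c d
  proof (rule propagates_bilinear[OF tensor_bilinear propagates_Sym2[OF V] propagates_Sym2[OF W] _ that])
    show "tensor (Sym2 V) (Sym2 W) u x \<in> span ?G" if "u \<in> sq V ` V" "x \<in> sq W ` W" for u x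
      using that by (blast intro: span_base)
  qed (rule subspace_span)+
  then show "tensor_space (Sym2 V) (Sym2 W) \<subseteq> span ?G"
    unfolding tensor_space_def by (intro span_minimal subspace_span) blast
  show "span ?G \<subseteq> tensor_space (Sym2 V) (Sym2 W)"
    unfolding tensor_space_def
    by (intro span_mono Collect_mono) (use sq_in_Sym2[of _ V] sq_in_Sym2[of _ W] in blast)
qed

lemma multi_tensor_cone_psd:
  assumes V: "\<And>i. subspace (V i)"
  shows "multi_tensor_cone (\<lambda>i. psd (V i)) =
      convex_cone hull {multi_tensor (\<lambda>i. Sym2 (V i)) (\<lambda>i. sq (V i) (v i)) | v. \<forall>i. v i \<in> V i}"
    (is "_ = convex_cone hull ?G")
proof
  have "multi_tensor (\<lambda>i. Sym2 (V i)) c \<in> convex_cone hull ?G" if "\<And>i. c i \<in> psd (V i)" for c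
  proof (rule propagates_multilinear[OF multi_tensor_multilinear propagates_psd[OF V] _ that])
    fix u assume "\<And>i. u i \<in> sq (V i) ` V i"
    then obtain v where "\<And>i. v i \<in> V i \<and> u i = sq (V i) (v i)" unfolding image_iff by metis
    then have "u = (\<lambda>i. sq (V i) (v i))" "\<forall>i. v i \<in> V i" by auto
    then show "multi_tensor (\<lambda>i. Sym2 (V i)) u \<in> convex_cone hull ?G" by (blast intro: hull_inc)
  qed (rule convex_cone_convex_cone_hull)
  then show "multi_tensor_cone (\<lambda>i. psd (V i)) \<subseteq> convex_cone hull ?G"
    unfolding multi_tensor_cone_def span_psd[OF V]
    by (intro hull_minimal convex_cone_convex_cone_hull) blast
  show "convex_cone hull ?G \<subseteq> multi_tensor_cone (\<lambda>i. psd (V i))"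
    unfolding multi_tensor_cone_def span_psd[OF V]
    by (intro hull_mono Collect_mono) (use sq_in_psd[OF V] in blast)
qed

lemma multi_tensor_space_Sym2:
  assumes V: "\<And>i. subspace (V i)"
  shows "multi_tensor_space (\<lambda>i. Sym2 (V i)) =
      span {multi_tensor (\<lambda>i. Sym2 (V i)) (\<lambda>i. sq (V i) (v i)) | v. \<forall>i. v i \<in> V i}"
    (is "_ = span ?G")
proof
  have "multi_tensor (\<lambda>i. Sym2 (V i)) c \<in> span ?G" if "\<And>i. c i \<in> Sym2 (V i)" for c
  proof (rule propagates_multilinear[OF multi_tensor_multilinear propagates_Sym2[OF V] _ that])
    fix u assume "\<And>i. u i \<in> sq (V i) ` V i"
    then obtain v where "\<And>i. v i \<in> V i \<and> u i = sq (V i) (v i)" unfolding image_iff by metis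
    then have "u = (\<lambda>i. sq (V i) (v i))" "\<forall>i. v i \<in> V i" by auto
    then show "multi_tensor (\<lambda>i. Sym2 (V i)) u \<in> span ?G" by (blast intro: span_base)
  qed (rule subspace_span)
  then show "multi_tensor_space (\<lambda>i. Sym2 (V i)) \<subseteq> span ?G"
    unfolding multi_tensor_space_def by (intro span_minimal subspace_span) blast
  show "span ?G \<subseteq> multi_tensor_space (\<lambda>i. Sym2 (V i))"
    unfolding multi_tensor_space_def
    by (intro span_mono Collect_mono) (use sq_in_Sym2[of _ "V _"] in blast)
qed

lemma sym_cone_psd:
  assumes V: "subspace V"
  shows "sym_cone (psd V) =
      convex_cone hull {sym_prod (Sym2 V) (\<lambda>i::'n::finite. sq V (v i)) | v. \<forall>i. v i \<in> V}"
    (is "_ = convex_cone hull ?G")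
proof
  have "sym_prod (Sym2 V) c \<in> convex_cone hull ?G" if "\<And>i::'n. c i \<in> psd V" for c
  proof (rule propagates_multilinear[OF sym_prod_multilinear propagates_psd[OF V] _ that])
    fix u :: "'n \<Rightarrow> _" assume "\<And>i. u i \<in> sq V ` V"
    then obtain v where "\<And>i. v i \<in> V \<and> u i = sq V (v i)" unfolding image_iff by metis
    then have "u = (\<lambda>i. sq V (v i))" "\<forall>i. v i \<in> V" by auto
    then show "sym_prod (Sym2 V) u \<in> convex_cone hull ?G" by (blast intro: hull_inc)
  qed (rule convex_cone_convex_cone_hull)
  then show "sym_cone (psd V) \<subseteq> convex_cone hull ?G"
    unfolding sym_cone_def span_psd[OF V]
    by (intro hull_minimal convex_cone_convex_cone_hull) blast
  show "convex_cone hull ?G \<subseteq> sym_cone (psd V)"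
    unfolding sym_cone_def span_psd[OF V]
    by (intro hull_mono Collect_mono) (use sq_in_psd[OF V] in blast)
qed

lemma sym_power_Sym2:
  assumes V: "subspace V"
  shows "sym_power (Sym2 V) =
      span {sym_prod (Sym2 V) (\<lambda>i::'n::finite. sq V (v i)) | v. \<forall>i. v i \<in> V}"
    (is "_ = span ?G")
proof
  have "sym_prod (Sym2 V) c \<in> span ?G" if "\<And>i::'n. c i \<in> Sym2 V" for c
  proof (rule propagates_multilinear[OF sym_prod_multilinear propagates_Sym2[OF V] _ that])
    fix u :: "'n \<Rightarrow> _" assume "\<And>i. u i \<in> sq V ` V"
    then obtain v where "\<And>i. v i \<in> V \<and> u i = sq V (v i)" unfolding image_iff by metis
    then have "u = (\<lambda>i. sq V (v i))" "\<forall>i. v i \<in> V" by auto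
    then show "sym_prod (Sym2 V) u \<in> span ?G" by (blast intro: span_base)
  qed (rule subspace_span)
  then show "sym_power (Sym2 V) \<subseteq> span ?G"
    unfolding sym_power_def by (intro span_minimal subspace_span) blast
  show "span ?G \<subseteq> sym_power (Sym2 V)"
    unfolding sym_power_def
    by (intro span_mono Collect_mono) (use sq_in_Sym2[of _ V] in blast)
qed

lemma veronese_cone_subset:
  assumes V: "subspace V"
  shows "convex_cone hull {sym_prod (Sym2 V) (\<lambda>_::'n::finite. sq V v) | v. v \<in> V} \<subseteq> sym_cone (psd V)"
  unfolding sym_cone_psd[OF V] by (intro hull_mono Collect_mono) auto

lemma fin_dim_le_1_span:
  assumes V: "fin_dim V" and dim: "dim V \<le> 1"
  shows "\<exists>e. V = span {e}"
proof -
  obtain B where finB: "finite B" and B: "independent B" and VB: "V = span B"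
    using fin_dim_basis[OF V] by blast
  have "card B \<le> 1" using dim B by (simp add: VB dim_eq_card_independent)
  then have "card B = 0 \<or> card B = 1" by linarith
  then show ?thesis
  proof
    assume "card B = 0"
    then have "V = span {0}" using finB by (simp add: VB)
    then show ?thesis by blast
  next
    assume "card B = 1"
    then show ?thesis using VB card_1_singletonE by blast
  qed
qed

text \<open>With one factor, products of squares are powers of squares.  If \<open>V\<close> is spanned by a single vector \<open>e\<close>,
all squares are nonnegative multiples of \<open>e\<^sup>2\<close>, so the symmetric power of the PSD cone is generated by
the power of \<open>e\<^sup>2\<close>.\<close>

lemma sym_cone_psd_veronese:
  assumes V: "fin_dim V" and small: "CARD('n::finite) = 1 \<or> dim V \<le> 1"
  shows "sym_cone (psd V) = convex_cone hull {sym_prod (Sym2 V) (\<lambda>_::'n. sq V v) | v. v \<in> V}"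
    (is "_ = convex_cone hull ?G")
proof
  have subV: "subspace V" using V by (rule subspace_fin_dim)
  show "convex_cone hull ?G \<subseteq> sym_cone (psd V)" by (rule veronese_cone_subset[OF subV])
  show "sym_cone (psd V) \<subseteq> convex_cone hull ?G"
    using small
  proof
    assume "CARD('n) = 1"
    then obtain k :: 'n where k: "UNIV = {k}" by (rule card_1_singletonE)
    have const: "(\<lambda>i::'n. sq V (v i)) = (\<lambda>_. sq V (v k))" for v
    proof
      fix i :: 'n
      have "i = k" using k UNIV_I[of i] by blast
      then show "sq V (v i) = sq V (v k)" by simp
    qed
    have "sym_prod (Sym2 V) (\<lambda>i::'n. sq V (v i)) \<in> ?G" if "\<forall>i. v i \<in> V" for v
      unfolding const[of v] using that by blast
    then show ?thesis unfolding sym_cone_psd[OF subV] by (intro hull_mono) blast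
  next
    assume "dim V \<le> 1"
    then obtain e where e: "V = span {e}" using fin_dim_le_1_span[OF V] by blast
    have eV: "e \<in> V" by (simp add: e span_base)
    have "sq V v \<in> convex_cone hull {sq V e}" if "v \<in> V" for v
    proof -
      obtain t where "v = t *\<^sub>R e" using \<open>v \<in> V\<close> by (auto simp: e span_singleton)
      then show ?thesis using sq_scale[OF eV subV] by (simp add: convex_cone_hull_mul hull_inc)
    qed
    then have psd: "psd V \<subseteq> convex_cone hull {sq V e}"
      unfolding psd_eq_hull[OF subV] by (intro hull_minimal) (auto simp: convex_cone_convex_cone_hull)
    have "sym_prod (Sym2 V) c \<in> convex_cone hull ?G" if c: "\<forall>i::'n. c i \<in> psd V" for c
    proof (rule propagates_multilinear[OF sym_prod_multilinear propagates_cone])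
      show "c i \<in> convex_cone hull {sq V e}" for i using c psd by blast
      show "{sq V e} \<subseteq> Sym2 V" using eV by (simp add: sym2_mult_in)
      fix u :: "'n \<Rightarrow> _" assume "\<And>i. u i \<in> {sq V e}"
      then have "u = (\<lambda>_. sq V e)" by auto
      then show "sym_prod (Sym2 V) u \<in> convex_cone hull ?G" using eV by (blast intro: hull_inc)
    qed (simp_all add: subspace_Sym2 convex_cone_convex_cone_hull)
    then show ?thesis
      unfolding sym_cone_def span_psd[OF subV]
      by (intro hull_minimal convex_cone_convex_cone_hull) blast
  qed
qed

section \<open>The dual of the PSD cone\<close>

text \<open>An element of \<open>Sym2 (dual V)\<close> with nonnegative values at all squares defines a positive semidefinite
form on \<open>V\<close>.  That form is a sum of squares of functionals, and the pairing is injective, so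
the element is the same sum of squares.\<close>

lemma psd_dual_eq:
  assumes V: "fin_dim V"
  shows "psd (dual V) = {P \<in> Sym2 (dual V). \<forall>A\<in>sq V ` V. 0 \<le> sym2_pairing V P A}"
proof (intro equalityI subsetI)
  have subV: "subspace V" using V by (rule subspace_fin_dim)
  fix P assume P: "P \<in> psd (dual V)"
  have "P \<in> Sym2 (dual V)" using P span_psd[OF subspace_dual] span_base by blast
  moreover have "0 \<le> sym2_pairing V P (sq V v)" if v: "v \<in> V" for v
  proof -
    have "linear_on (Sym2 (dual V)) (\<lambda>P. sym2_pairing V P (sq V v))"
      by (simp add: linear_on_def sym2_pairing_def)
    moreover have "(\<lambda>P. sym2_pairing V P (sq V v)) ` sq (dual V) ` dual V \<subseteq> {0..}"
      using v by (auto simp: sym2_pairing_mult)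
    ultimately have "(\<lambda>P. sym2_pairing V P (sq V v)) ` psd (dual V) \<subseteq> {0..}"
      using propagates_psd[OF subspace_dual convex_cone_nonneg, of V]
      unfolding propagates_def by blast
    with P show ?thesis by auto
  qed
  ultimately show "P \<in> {P \<in> Sym2 (dual V). \<forall>A\<in>sq V ` V. 0 \<le> sym2_pairing V P A}" by auto
next
  have subV: "subspace V" using V by (rule subspace_fin_dim)
  fix P assume "P \<in> {P \<in> Sym2 (dual V). \<forall>A\<in>sq V ` V. 0 \<le> sym2_pairing V P A}"
  then have P: "P \<in> Sym2 (dual V)" and pos: "\<And>v. v \<in> V \<Longrightarrow> 0 \<le> sym2_pairing V P (sq V v)" by auto
  have "sym_bilinear_on V (\<lambda>u v. sym2_pairing V P (sym2_mult V u v))"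
    using sym2_mult_sym_bilinear[of V] sym2_pairing_linear[OF P] sym2_mult_in[of _ V]
    by (auto simp: sym_bilinear_on_def bilinear_on_def linear_on_def)
  from psd_form_sum_of_squares[OF V this pos] obtain m :: nat and f
    where f: "\<And>k. k < m \<Longrightarrow> f k \<in> dual V"
      and eq: "\<And>u v. u \<in> V \<Longrightarrow> v \<in> V \<Longrightarrow> sym2_pairing V P (sym2_mult V u v) = (\<Sum>k<m. f k u * f k v)"
    by blast
  let ?R = "\<Sum>k<m. sq (dual V) (f k)"
  have R: "?R \<in> psd (dual V)" unfolding psd_def using f by blast
  then have R2: "?R \<in> Sym2 (dual V)" using span_psd[OF subspace_dual] span_base by blast
  have "sym2_pairing V ?R = (\<Sum>k<m. sym2_pairing V (sq (dual V) (f k)))"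
    using linear_on_sum[OF linear_on_sym2_pairing subspace_Sym2, of "{..<m}" "\<lambda>k. sq (dual V) (f k)" "dual V" V "\<lambda>_. 1"]
      f by (simp add: sym2_mult_in)
  then have "sym2_pairing V ?R (sym2_mult V u v) = sym2_pairing V P (sym2_mult V u v)" if "u \<in> V" "v \<in> V" for u v
    using f eq that by (simp add: sum_fun_apply sym2_pairing_mult)
  then have "sym2_pairing V ?R = sym2_pairing V P"
    using sym2_pairing_dual[OF P] sym2_pairing_dual[OF R2]
    by (intro dual_eqI[of _ "{sym2_mult V u v |u v. u \<in> V \<and> v \<in> V}"]) (auto simp flip: Sym2_def)
  then have "P = ?R"
    using sym2_pairing_bij[OF V] P R2 by (auto simp: bij_betw_def inj_on_def)
  with R show "P \<in> psd (dual V)" by simp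
qed

lemma identifies_psd_dual:
  assumes V: "fin_dim V"
  shows "identifies (sym2_pairing V) (Sym2 (dual V)) (psd (dual V)) (dual (Sym2 V)) (dual_cone (psd V))"
  using subspace_fin_dim[OF V] psd_eq_hull Sym2_eq_span_squares
  by (intro identifies_dual_coneI[OF linear_on_sym2_pairing sym2_pairing_bij[OF V] _ _ psd_dual_eq[OF V]])

section \<open>The duals of tensor products of PSD cones\<close>

lemma linear_on_quad_eval: "linear_on X (\<lambda>P. quad_eval P v)"
  by (simp add: linear_on_def quad_eval_def)

text \<open>The bridge between functionals and polynomials, here for one factor and below for several:
pairing with squares of vectors is evaluation at these vectors.\<close>

lemma sym2_pairing_sq:
  assumes P: "P \<in> Sym2 (dual V)" and v: "v \<in> V"
  shows "sym2_pairing V P (sq V v) = quad_eval P v"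
  using _ linear_on_quad_eval _ P[unfolded Sym2_def]
proof (rule linear_on_eq_on_span)
  show "linear_on (span {sym2_mult (dual V) u v |u v. u \<in> dual V \<and> v \<in> dual V}) (\<lambda>P. sym2_pairing V P (sq V v))"
    by (simp add: linear_on_def sym2_pairing_def)
qed (use v in \<open>auto simp: sym2_pairing_mult quad_eval_mult\<close>)

lemma biquad_eval_tensor:
  "biquad_eval (tensor (Sym2 (dual V)) (Sym2 (dual W)) P R) v w = quad_eval P v * quad_eval R w"
  by (simp add: biquad_eval_def tensor_def bilinear_on_product linear_on_quad_eval)

lemma tensor_pairing_sq:
  assumes Q: "Q \<in> biquad_polys V W" and vw: "v \<in> V" "w \<in> W"
  shows "tensor_pairing V W Q (tensor (Sym2 V) (Sym2 W) (sq V v) (sq W w)) = biquad_eval Q v w"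
proof -
  let ?G = "{tensor (Sym2 (dual V)) (Sym2 (dual W)) P R |P R. P \<in> Sym2 (dual V) \<and> R \<in> Sym2 (dual W)}"
  have "linear_on (span ?G) (\<lambda>Q. tensor_pairing V W Q (tensor (Sym2 V) (Sym2 W) (sq V v) (sq W w)))"
    by (simp add: linear_on_def tensor_pairing_def)
  moreover have "linear_on (span ?G) (\<lambda>Q. biquad_eval Q v w)"
    by (simp add: linear_on_def biquad_eval_def)
  moreover have "tensor_pairing V W Q (tensor (Sym2 V) (Sym2 W) (sq V v) (sq W w)) = biquad_eval Q v w"
    if "Q \<in> ?G" for Q
  proof -
    from that obtain P R where Q: "Q = tensor (Sym2 (dual V)) (Sym2 (dual W)) P R"
      and PR: "P \<in> Sym2 (dual V)" "R \<in> Sym2 (dual W)" by blast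
    show ?thesis
      unfolding Q biquad_eval_tensor using PR vw
      by (simp add: tensor_pairing_tensor_tensor sq_in_Sym2 sym2_pairing_sq)
  qed
  ultimately show ?thesis
    using linear_on_eq_on_span[of ?G] Q[unfolded tensor_space_def] by blast
qed

lemma identifies_tensor_pairing:
  assumes V: "fin_dim V" and W: "fin_dim W"
  shows "identifies (tensor_pairing V W)
      (biquad_polys V W) (nonneg_biquad_polys V W)
      (dual (tensor_space (Sym2 V) (Sym2 W))) (dual_cone (tensor_cone (psd V) (psd W)))"
proof (rule identifies_dual_coneI[OF linear_on_tensor_pairing tensor_pairing_bij[OF V W]
      tensor_cone_psd tensor_space_Sym2])
  show "nonneg_biquad_polys V W = {Q \<in> biquad_polys V W.
      \<forall>T\<in>{tensor (Sym2 V) (Sym2 W) (sq V v) (sq W w) |v w. v \<in> V \<and> w \<in> W}. 0 \<le> tensor_pairing V W Q T}"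
    by (force simp: nonneg_biquad_polys_def tensor_pairing_sq)
qed (use V W subspace_fin_dim in auto)

lemma multiquad_eval_multi_tensor:
  "multiquad_eval (multi_tensor (\<lambda>i. Sym2 (dual (V i))) P) v = (\<Prod>i\<in>UNIV. quad_eval (P i) (v i))"
  using multilinear_on_prod[of "\<lambda>i. Sym2 (dual (V i))" "\<lambda>i P. quad_eval P (v i)", OF linear_on_quad_eval]
  by (simp add: multiquad_eval_def multi_tensor_def)

lemma multi_tensor_pairing_sq:
  assumes Q: "Q \<in> multiquad_polys V" and v: "\<And>i. v i \<in> V i"
  shows "multi_tensor_pairing V Q (multi_tensor (\<lambda>i. Sym2 (V i)) (\<lambda>i. sq (V i) (v i))) = multiquad_eval Q v"
    (is "multi_tensor_pairing V Q ?T = _")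
proof -
  let ?G = "{multi_tensor (\<lambda>i. Sym2 (dual (V i))) P |P. \<forall>i. P i \<in> Sym2 (dual (V i))}"
  have "linear_on (span ?G) (\<lambda>Q. multi_tensor_pairing V Q ?T)"
    by (simp add: linear_on_def multi_tensor_pairing_def)
  moreover have "linear_on (span ?G) (\<lambda>Q. multiquad_eval Q v)"
    by (simp add: linear_on_def multiquad_eval_def)
  moreover have "multi_tensor_pairing V Q ?T = multiquad_eval Q v" if "Q \<in> ?G" for Q
  proof -
    from that obtain P where Q: "Q = multi_tensor (\<lambda>i. Sym2 (dual (V i))) P"
      and P: "\<And>i. P i \<in> Sym2 (dual (V i))" by blast
    show ?thesis
      unfolding Q multiquad_eval_multi_tensor using P v
      by (simp add: multi_tensor_pairing_multi_tensor_multi_tensor sq_in_Sym2 sym2_pairing_sq)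
  qed
  ultimately show ?thesis
    using linear_on_eq_on_span[of ?G] Q[unfolded multi_tensor_space_def] by blast
qed

lemma identifies_multi_tensor_pairing:
  assumes V: "\<And>i. fin_dim (V i)"
  shows "identifies (multi_tensor_pairing V)
      (multiquad_polys V) (nonneg_multiquad_polys V)
      (dual (multi_tensor_space (\<lambda>i. Sym2 (V i)))) (dual_cone (multi_tensor_cone (\<lambda>i. psd (V i))))"
proof (rule identifies_dual_coneI[OF linear_on_multi_tensor_pairing multi_tensor_pairing_bij[OF V]
      multi_tensor_cone_psd multi_tensor_space_Sym2])
  show "nonneg_multiquad_polys V = {Q \<in> multiquad_polys V.
      \<forall>T\<in>{multi_tensor (\<lambda>i. Sym2 (V i)) (\<lambda>i. sq (V i) (v i)) |v. \<forall>i. v i \<in> V i}. 0 \<le> multi_tensor_pairing V Q T}"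
    by (force simp: nonneg_multiquad_polys_def multi_tensor_pairing_sq)
qed (use V subspace_fin_dim in auto)

section \<open>The dual cone as a cone of homomorphisms\<close>

lemma hom_pairing_tensor:
  assumes h: "h \<in> lin_maps (Sym2 V) (Sym2 (dual W))" and AB: "A \<in> Sym2 V" "B \<in> Sym2 W"
  shows "hom_pairing V W h (tensor (Sym2 V) (Sym2 W) A B) = sym2_pairing W (h A) B"
proof -
  have "bilinear_on (Sym2 V) (Sym2 W) (\<lambda>A B. sym2_pairing W (h A) B)"
    using h sym2_pairing_linear[of "h _" W] linear_on_sym2_pairing[of UNIV W]
    by (auto simp: bilinear_on_def lin_maps_def linear_on_def image_subset_iff)
  then show ?thesis using AB by (simp add: hom_pairing_def tensor_in) (simp add: tensor_def)
qed

lemma hom_pairing_dual: "hom_pairing V W h \<in> dual (tensor_space (Sym2 V) (Sym2 W))"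
  unfolding hom_pairing_def by (rule restrict_dual) (auto simp: linear_on_def subspace_tensor_space)

lemma linear_on_hom_pairing:
  "linear_on (lin_maps (Sym2 V) (Sym2 (dual W))) (hom_pairing V W)"
proof -
  let ?L = "lin_maps (Sym2 V) (Sym2 (dual W))"
  have L: "h + k \<in> ?L" "c *\<^sub>R h \<in> ?L" if "h \<in> ?L" "k \<in> ?L" for h k c
    using that subspace_Sym2[of "dual W"]
    by (auto simp: lin_maps_def linear_on_def algebra_simps subspace_add subspace_scale image_subset_iff)
  have ext: "\<phi> = \<psi>" if "\<phi> \<in> dual (tensor_space (Sym2 V) (Sym2 W))" "\<psi> \<in> dual (tensor_space (Sym2 V) (Sym2 W))"
    "\<And>A B. A \<in> Sym2 V \<Longrightarrow> B \<in> Sym2 W \<Longrightarrow> \<phi> (tensor (Sym2 V) (Sym2 W) A B) = \<psi> (tensor (Sym2 V) (Sym2 W) A B)"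
    for \<phi> \<psi>
    using that unfolding tensor_space_def by (intro dual_eqI) auto
  have lin: "sym2_pairing W (P + R) B = sym2_pairing W P B + sym2_pairing W R B"
    "sym2_pairing W (c *\<^sub>R P) B = c * sym2_pairing W P B" for P R B c
    by (simp_all add: sym2_pairing_def)
  show ?thesis
    unfolding linear_on_def
    by (intro conjI ballI allI ext)
      (simp_all add: hom_pairing_dual subspace_add[OF subspace_dual] subspace_scale[OF subspace_dual]
        hom_pairing_tensor L lin)
qed

text \<open>For fixed \<open>A\<close>, the functional \<open>B \<mapsto> \<phi>(A \<otimes> B)\<close> is the pairing with a unique element \<open>h A\<close> of
\<open>Sym2 (dual W)\<close>.  Uniqueness makes \<open>h\<close> linear.\<close>

lemma hom_pairing_bij:
  assumes W: "fin_dim W"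
  shows "bij_betw (hom_pairing V W) (lin_maps (Sym2 V) (Sym2 (dual W))) (dual (tensor_space (Sym2 V) (Sym2 W)))"
  unfolding bij_betw_def
proof (intro conjI)
  let ?p = "sym2_pairing W" and ?S = "Sym2 (dual W)" and ?t = "tensor (Sym2 V) (Sym2 W)"
  have inj: "inj_on ?p ?S" and surj: "?p ` ?S = dual (Sym2 W)"
    using sym2_pairing_bij[OF W] by (auto simp: bij_betw_def)
  show "inj_on (hom_pairing V W) (lin_maps (Sym2 V) ?S)"
  proof (rule inj_onI)
    fix h k
    assume h: "h \<in> lin_maps (Sym2 V) ?S" and k: "k \<in> lin_maps (Sym2 V) ?S"
      and eq: "hom_pairing V W h = hom_pairing V W k"
    have "h A = k A" for A
    proof (cases "A \<in> Sym2 V")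
      case True
      have hk: "h A \<in> ?S" "k A \<in> ?S" using lin_maps_into[OF h True] lin_maps_into[OF k True] .
      have "?p (h A) B = ?p (k A) B" if "B \<in> Sym2 W" for B
        using hom_pairing_tensor[OF h True that] hom_pairing_tensor[OF k True that] eq by simp
      then show ?thesis by (rule sym2_pairing_eqI[OF W hk])
    next
      case False
      show ?thesis unfolding lin_maps_outside[OF h False] lin_maps_outside[OF k False] ..
    qed
    then show "h = k" by (rule ext)
  qed
  have "\<phi> \<in> hom_pairing V W ` lin_maps (Sym2 V) ?S" if \<phi>: "\<phi> \<in> dual (tensor_space (Sym2 V) (Sym2 W))" for \<phi>
  proof -
    define s where "s A B = (if B \<in> Sym2 W then \<phi> (?t A B) else 0)" for A B
    have \<phi>': "\<phi> (x + y) = \<phi> x + \<phi> y" "\<phi> (c *\<^sub>R x) = c * \<phi> x"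
      if "x \<in> tensor_space (Sym2 V) (Sym2 W)" "y \<in> tensor_space (Sym2 V) (Sym2 W)" for x y c
      using \<phi> that by (simp_all add: dual_iff linear_on_def)
    note t = tensor_in[of _ "Sym2 V" _ "Sym2 W"]
    have bil: "linear_on (Sym2 W) (?t A)" "linear_on (Sym2 V) (\<lambda>A. ?t A B)"
      if "A \<in> Sym2 V" "B \<in> Sym2 W" for A B
      using tensor_bilinear[of "Sym2 V" "Sym2 W"] that unfolding bilinear_on_def by blast+
    have linV: "\<phi> (?t (A + C) B) = \<phi> (?t A B) + \<phi> (?t C B)" "\<phi> (?t (c *\<^sub>R A) B) = c * \<phi> (?t A B)"
      if A: "A \<in> Sym2 V" and C: "C \<in> Sym2 V" and B: "B \<in> Sym2 W" for A C B c
    proof -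
      have "?t (A + C) B = ?t A B + ?t C B" "?t (c *\<^sub>R A) B = c *\<^sub>R ?t A B"
        using bil(2)[OF A B] A C unfolding linear_on_def by blast+
      then show "\<phi> (?t (A + C) B) = \<phi> (?t A B) + \<phi> (?t C B)" "\<phi> (?t (c *\<^sub>R A) B) = c * \<phi> (?t A B)"
        by (simp_all only: \<phi>'[OF t[OF A B] t[OF C B]])
    qed
    have linW: "\<phi> (?t A (B + D)) = \<phi> (?t A B) + \<phi> (?t A D)" "\<phi> (?t A (c *\<^sub>R B)) = c * \<phi> (?t A B)"
      if A: "A \<in> Sym2 V" and B: "B \<in> Sym2 W" and D: "D \<in> Sym2 W" for A B D c
    proof -
      have "?t A (B + D) = ?t A B + ?t A D" "?t A (c *\<^sub>R B) = c *\<^sub>R ?t A B"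
        using bil(1)[OF A B] B D unfolding linear_on_def by blast+
      then show "\<phi> (?t A (B + D)) = \<phi> (?t A B) + \<phi> (?t A D)" "\<phi> (?t A (c *\<^sub>R B)) = c * \<phi> (?t A B)"
        by (simp_all only: \<phi>'[OF t[OF A B] t[OF A D]])
    qed
    have s: "s A \<in> dual (Sym2 W)" if "A \<in> Sym2 V" for A
      unfolding s_def by (intro restrict_dual subspace_Sym2) (simp add: linear_on_def linW(1)[OF that] linW(2)[OF that _ subspace_0[OF subspace_Sym2]])
    define h where "h A = (if A \<in> Sym2 V then inv_into ?S ?p (s A) else 0)" for A
    have hS: "h A \<in> ?S" and ph: "?p (h A) = s A" if "A \<in> Sym2 V" for A
    proof -
      have "s A \<in> ?p ` ?S" using s[OF that] surj by simp
      then show "h A \<in> ?S" "?p (h A) = s A"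
        using that by (simp_all only: h_def if_True inv_into_into f_inv_into_f)
    qed
    have plin: "?p (P + R) = ?p P + ?p R" "?p (c *\<^sub>R P) = c *\<^sub>R ?p P" for P R c
      using linear_on_sym2_pairing[of UNIV W] by (simp_all only: linear_on_def UNIV_I simp_thms)
    have slin: "s (A + C) = s A + s C" "s (c *\<^sub>R A) = c *\<^sub>R s A" if "A \<in> Sym2 V" "C \<in> Sym2 V" for A C c
      by (rule ext, simp add: s_def linV[OF that])+
    have "h (A + C) = h A + h C" if AC: "A \<in> Sym2 V" "C \<in> Sym2 V" for A C
    proof (rule inj_onD[OF inj])
      have ACS: "A + C \<in> Sym2 V" using AC by (rule subspace_add[OF subspace_Sym2])
      show "?p (h (A + C)) = ?p (h A + h C)"
        unfolding plin ph[OF AC(1)] ph[OF AC(2)] ph[OF ACS] slin[OF AC] ..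
      show "h (A + C) \<in> ?S" using ACS by (rule hS)
      show "h A + h C \<in> ?S" using hS[OF AC(1)] hS[OF AC(2)] by (rule subspace_add[OF subspace_Sym2])
    qed
    moreover have "h (c *\<^sub>R A) = c *\<^sub>R h A" if A: "A \<in> Sym2 V" for A c
    proof (rule inj_onD[OF inj])
      have cA: "c *\<^sub>R A \<in> Sym2 V" using A by (rule subspace_scale[OF subspace_Sym2])
      show "?p (h (c *\<^sub>R A)) = ?p (c *\<^sub>R h A)"
        unfolding plin ph[OF A] ph[OF cA] slin[OF A A] ..
      show "h (c *\<^sub>R A) \<in> ?S" using cA by (rule hS)
      show "c *\<^sub>R h A \<in> ?S" using hS[OF A] by (rule subspace_scale[OF subspace_Sym2])
    qed
    ultimately have "linear_on (Sym2 V) h" unfolding linear_on_def by blast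
    then have h: "h \<in> lin_maps (Sym2 V) ?S"
    proof -
      have "h ` Sym2 V \<subseteq> ?S" using hS by (rule image_subsetI)
      moreover have "h A = 0" if "A \<notin> Sym2 V" for A using that by (simp only: h_def if_False)
      ultimately show ?thesis using \<open>linear_on (Sym2 V) h\<close> unfolding lin_maps_def by blast
    qed
    have "hom_pairing V W h = \<phi>"
      unfolding tensor_space_def
    proof (rule dual_eqI)
      show "hom_pairing V W h \<in> dual (span {?t A B |A B. A \<in> Sym2 V \<and> B \<in> Sym2 W})"
        unfolding tensor_space_def[symmetric] by (rule hom_pairing_dual)
      show "\<phi> \<in> dual (span {?t A B |A B. A \<in> Sym2 V \<and> B \<in> Sym2 W})"
        unfolding tensor_space_def[symmetric] by (rule \<phi>)
      fix T assume "T \<in> {?t A B |A B. A \<in> Sym2 V \<and> B \<in> Sym2 W}"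
      then obtain A B where T: "T = ?t A B" and AB: "A \<in> Sym2 V" "B \<in> Sym2 W" by blast
      show "hom_pairing V W h T = \<phi> T"
        unfolding T hom_pairing_tensor[OF h AB] ph[OF AB(1)] s_def using AB(2) by (simp only: if_True)
    qed
    with h show ?thesis by blast
  qed
  then show "hom_pairing V W ` lin_maps (Sym2 V) ?S = dual (tensor_space (Sym2 V) (Sym2 W))"
    using hom_pairing_dual by blast
qed

text \<open>Self-duality of the PSD cone of \<open>W\<close> replaces the condition that \<open>h (v\<^sup>2)\<close> is positive semidefinite by
inequalities.\<close>

lemma Hom_AC_psd_eq:
  assumes V: "fin_dim V" and W: "fin_dim W"
  shows "Hom_AC (psd V) (psd (dual W)) = {h \<in> lin_maps (Sym2 V) (Sym2 (dual W)).
    \<forall>v\<in>V. \<forall>w\<in>W. 0 \<le> sym2_pairing W (h (sq V v)) (sq W w)}"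
proof -
  have subV: "subspace V" using V by (rule subspace_fin_dim)
  have cone: "convex_cone (psd (dual W))"
    by (simp add: psd_eq_hull subspace_dual convex_cone_convex_cone_hull)
  have "h ` psd V \<subseteq> psd (dual W) \<longleftrightarrow> (\<forall>v\<in>V. h (sq V v) \<in> psd (dual W))"
    if "h \<in> lin_maps (Sym2 V) (Sym2 (dual W))" for h
  proof
    assume "\<forall>v\<in>V. h (sq V v) \<in> psd (dual W)"
    then show "h ` psd V \<subseteq> psd (dual W)"
      using propagates_psd[OF subV cone] that
      by (auto simp: propagates_def lin_maps_def image_subset_iff)
  qed (use sq_in_psd[OF subV] in auto)
  moreover have "h (sq V v) \<in> psd (dual W) \<longleftrightarrow> (\<forall>w\<in>W. 0 \<le> sym2_pairing W (h (sq V v)) (sq W w))"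
    if "h \<in> lin_maps (Sym2 V) (Sym2 (dual W))" "v \<in> V" for h v
    using that unfolding psd_dual_eq[OF W] by (auto simp: lin_maps_def sym2_mult_in)
  ultimately show ?thesis
    unfolding Hom_AC_def span_psd[OF subV] span_psd[OF subspace_dual] by auto
qed

lemma identifies_hom_pairing:
  assumes V: "fin_dim V" and W: "fin_dim W"
  shows "identifies (hom_pairing V W)
      (lin_maps (Sym2 V) (Sym2 (dual W))) (Hom_AC (psd V) (psd (dual W)))
      (dual (tensor_space (Sym2 V) (Sym2 W))) (dual_cone (tensor_cone (psd V) (psd W)))"
proof (rule identifies_dual_coneI[OF linear_on_hom_pairing hom_pairing_bij[OF W]
      tensor_cone_psd tensor_space_Sym2])
  show "Hom_AC (psd V) (psd (dual W)) = {h \<in> lin_maps (Sym2 V) (Sym2 (dual W)).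
      \<forall>T\<in>{tensor (Sym2 V) (Sym2 W) (sq V v) (sq W w) |v w. v \<in> V \<and> w \<in> W}. 0 \<le> hom_pairing V W h T}"
    unfolding Hom_AC_psd_eq[OF V W] by (force simp: hom_pairing_tensor sym2_mult_in)
qed (use V W subspace_fin_dim in auto)

section \<open>The dual of the symmetric power\<close>

text \<open>A functional on the symmetric power gives one on the tensor power, through the canonical projection of
the tensor power, and functionals on the tensor power are polynomials.\<close>

lemma square_eval_is_poly:
  fixes \<phi> :: "('n::finite, 'a::real_vector sym2) multi_tensors \<Rightarrow> real"
  assumes V: "fin_dim V" and \<phi>: "\<phi> \<in> dual (sym_power (Sym2 V))"
  shows "\<exists>Q\<in>multiquad_polys (\<lambda>_::'n. V). square_eval V \<phi> = poly_fun V Q"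
proof -
  let ?S = "\<lambda>_::'n. Sym2 V"
  have in_pow: "sym_prod (Sym2 V) A \<in> sym_power (Sym2 V)" if "\<forall>i::'n. A i \<in> Sym2 V" for A
    unfolding sym_power_def using that by (intro span_base) blast
  have "multilinear_on ?S (\<lambda>A. \<phi> (sym_prod (Sym2 V) A))"
    unfolding multilinear_on_def
  proof (intro allI impI)
    fix A :: "'n \<Rightarrow> 'a sym2" and k assume A: "\<forall>i. A i \<in> Sym2 V"
    have "linear_on (Sym2 V) (\<lambda>x. sym_prod (Sym2 V) (A(k := x)))"
      using multilinear_onD[OF sym_prod_multilinear, of A "Sym2 V" k] A by simp
    moreover have "sym_prod (Sym2 V) (A(k := x)) \<in> sym_power (Sym2 V)" if "x \<in> Sym2 V" for x
      using A that by (intro in_pow) auto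
    ultimately show "linear_on (Sym2 V) (\<lambda>x. \<phi> (sym_prod (Sym2 V) (A(k := x))))"
      using \<phi> by (simp add: linear_on_def dual_iff)
  qed
  from multi_tensor_universal[OF this] obtain L where L: "linear L"
    "\<And>A. (\<forall>i. A i \<in> Sym2 V) \<Longrightarrow> L (multi_tensor ?S A) = \<phi> (sym_prod (Sym2 V) A)" by blast
  define \<psi> where "\<psi> T = (if T \<in> multi_tensor_space ?S then L T else 0)" for T
  have "\<psi> \<in> dual (multi_tensor_space ?S)"
    unfolding \<psi>_def by (intro restrict_dual subspace_multi_tensor_space)
      (simp add: linear_on_def linear_add[OF L(1)] linear_scale[OF L(1)])
  then have "\<psi> \<in> multi_tensor_pairing (\<lambda>_::'n. V) ` multiquad_polys (\<lambda>_::'n. V)"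
    using bij_betw_imp_surj_on[OF multi_tensor_pairing_bij[of "\<lambda>_::'n. V", OF V]] by simp
  then obtain Q where Q: "Q \<in> multiquad_polys (\<lambda>_::'n. V)" "multi_tensor_pairing (\<lambda>_. V) Q = \<psi>"
    by blast
  have "square_eval V \<phi> v = poly_fun V Q v" for v
  proof (cases "\<forall>i. v i \<in> V")
    case True
    then have S: "\<forall>i. sq V (v i) \<in> Sym2 V" by (simp add: sym2_mult_in)
    have "multiquad_eval Q v = \<psi> (multi_tensor ?S (\<lambda>i. sq V (v i)))"
      using multi_tensor_pairing_sq[OF Q(1), of v] True Q(2) by simp
    also have "\<dots> = \<phi> (sym_prod (Sym2 V) (\<lambda>i. sq V (v i)))"
      using S L(2)[OF S] multi_tensor_in[of "\<lambda>i. sq V (v i)" ?S] by (simp add: \<psi>_def)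
    finally show ?thesis using True by (simp add: square_eval_def poly_fun_def)
  qed (auto simp: square_eval_def poly_fun_def)
  with Q(1) show ?thesis by blast
qed

lemma square_eval_perm_invariant:
  fixes \<phi> :: "('n::finite, 'a::real_vector sym2) multi_tensors \<Rightarrow> real"
  shows "perm_invariant (square_eval V \<phi>)"
  unfolding perm_invariant_def
proof (intro allI impI)
  fix \<pi> :: "'n \<Rightarrow> 'n" and v :: "'n \<Rightarrow> 'a" assume \<pi>: "\<pi> permutes UNIV"
  have all: "(\<forall>i. v (\<pi> i) \<in> V) \<longleftrightarrow> (\<forall>i. v i \<in> V)"
    using permutes_surj[OF \<pi>] by (metis surjD)
  have "sym_prod (Sym2 V) ((\<lambda>i. sq V (v i)) \<circ> \<pi>) = sym_prod (Sym2 V) (\<lambda>i. sq V (v i))" if "\<forall>i. v i \<in> V"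
    by (rule sym_multilinear_onD[OF sym_prod_sym_multilinear \<pi>]) (simp add: sq_in_Sym2 that)
  then show "square_eval V \<phi> (v \<circ> \<pi>) = square_eval V \<phi> v"
    using all by (simp add: square_eval_def comp_def)
qed

text \<open>The multilinear form \<open>m\<close> given by \<open>Q\<close> has the values of the polynomial on squares.  Applying a
permutation of the slots to \<open>m\<close> gives another multilinear form, which agrees with \<open>m\<close> on squares by invariance and
hence everywhere, because squares span.  So \<open>m\<close> is symmetric and factors through the symmetric power.\<close>

lemma perm_invariant_poly_is_square_eval:
  fixes Q :: "('n::finite, ('a::real_vector \<Rightarrow> real) sym2) multi_tensors"
  assumes V: "subspace V" and Q: "Q \<in> multiquad_polys (\<lambda>_::'n. V)" and inv: "perm_invariant (poly_fun V Q)"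
  shows "\<exists>\<phi>\<in>dual (sym_power (Sym2 V)). square_eval V \<phi> = poly_fun V Q"
proof -
  let ?S = "\<lambda>_::'n. Sym2 V"
  define m where "m A = multi_tensor_pairing (\<lambda>_. V) Q (multi_tensor ?S A)" for A
  have p: "multi_tensor_pairing (\<lambda>_. V) Q \<in> dual (multi_tensor_space ?S)"
    using multi_tensor_pairing_dual[of "\<lambda>_::'n. V"] Q by blast
  have msq: "m (\<lambda>i. sq V (v i)) = poly_fun V Q v" if "\<forall>i. v i \<in> V" for v
    using multi_tensor_pairing_sq[OF Q, of v] that by (simp add: m_def poly_fun_def)
  have m: "multilinear_on ?S m"
    unfolding multilinear_on_def
  proof (intro allI impI)
    fix A :: "'n \<Rightarrow> 'a sym2" and k assume A: "\<forall>i. A i \<in> Sym2 V"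
    have "linear_on (Sym2 V) (\<lambda>x. multi_tensor ?S (A(k := x)))"
      using multilinear_onD[OF multi_tensor_multilinear, of A ?S k] A by simp
    moreover have "multi_tensor ?S (A(k := x)) \<in> multi_tensor_space ?S" if "x \<in> Sym2 V" for x
      using A that by (intro multi_tensor_in) auto
    ultimately show "linear_on (Sym2 V) (\<lambda>x. m (A(k := x)))"
      using p by (simp add: linear_on_def dual_iff m_def)
  qed
  have "m (A \<circ> \<pi>) = m A" if \<pi>: "\<pi> permutes UNIV" and A: "\<forall>i. A i \<in> Sym2 V" for \<pi> A
  proof -
    have upd: "A(k := x) \<circ> \<pi> = (A \<circ> \<pi>)(inv \<pi> k := x)" for A k and x :: "'a sym2"
      using permutes_inverses[OF \<pi>] by (auto simp: fun_eq_iff)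
    have lin\<pi>: "linear_on (Sym2 V) (\<lambda>x. m (A(k := x) \<circ> \<pi>))" if "\<forall>i. A i \<in> Sym2 V" for A k
      unfolding upd using that by (intro multilinear_onD[OF m]) auto
    have lin: "linear_on (Sym2 V) (\<lambda>x. m (A(k := x)))" if "\<forall>i. A i \<in> Sym2 V" for A k
      using that by (intro multilinear_onD[OF m]) auto
    have "multilinear_on ?S (\<lambda>A. m (A \<circ> \<pi>) - m A)"
      unfolding multilinear_on_def using lin\<pi> lin by (auto simp: linear_on_def algebra_simps)
    then have "m (A \<circ> \<pi>) - m A \<in> {0}"
    proof (rule propagates_multilinear[OF _ propagates_Sym2[OF V]])
      fix u :: "'n \<Rightarrow> 'a sym2" assume "\<And>i. u i \<in> sq V ` V"
      then obtain v where "\<And>i. v i \<in> V \<and> u i = sq V (v i)" unfolding image_iff by metis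
      then have u: "u = (\<lambda>i. sq V (v i))" and v: "\<forall>i. v i \<in> V" by auto
      have "u \<circ> \<pi> = (\<lambda>i. sq V ((v \<circ> \<pi>) i))" by (auto simp: u)
      then have "m (u \<circ> \<pi>) = poly_fun V Q (v \<circ> \<pi>)" using msq[of "v \<circ> \<pi>"] v by simp
      then show "m (u \<circ> \<pi>) - m u \<in> {0}"
        using msq[OF v] inv \<pi> unfolding perm_invariant_def u by simp
    qed (use A in \<open>auto simp: subspace_def\<close>)
    then show ?thesis by simp
  qed
  with m have "sym_multilinear_on (Sym2 V) m" by (simp add: sym_multilinear_on_def)
  from sym_power_universal[OF this] obtain L where L: "linear L"
    "\<And>A. (\<forall>i. A i \<in> Sym2 V) \<Longrightarrow> L (sym_prod (Sym2 V) A) = m A" by blast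
  define \<phi> where "\<phi> T = (if T \<in> sym_power (Sym2 V) then L T else 0)" for T :: "('n, 'a sym2) multi_tensors"
  have "\<phi> \<in> dual (sym_power (Sym2 V))"
    unfolding \<phi>_def by (intro restrict_dual)
      (simp_all add: linear_on_def linear_add[OF L(1)] linear_scale[OF L(1)] sym_power_def)
  moreover have "square_eval V \<phi> v = poly_fun V Q v" for v
  proof (cases "\<forall>i. v i \<in> V")
    case True
    then have S: "\<forall>i. sq V (v i) \<in> Sym2 V" by (simp add: sym2_mult_in)
    then have "sym_prod (Sym2 V) (\<lambda>i. sq V (v i)) \<in> sym_power (Sym2 V)"
      unfolding sym_power_def by (intro span_base) blast
    then show ?thesis using True L(2)[OF S] msq[OF True] by (simp add: square_eval_def \<phi>_def)
  qed (auto simp: square_eval_def poly_fun_def)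
  ultimately show ?thesis by blast
qed

text \<open>Products of squares span the symmetric power.\<close>

lemma square_eval_inj:
  assumes V: "subspace V"
  shows "inj_on (square_eval V) (dual (sym_power (Sym2 V) :: ('n::finite, _) multi_tensors set))"
proof (rule inj_onI)
  fix \<phi> \<psi> :: "('n, 'a sym2) multi_tensors \<Rightarrow> real"
  assume d: "\<phi> \<in> dual (sym_power (Sym2 V))" "\<psi> \<in> dual (sym_power (Sym2 V))"
    and eq: "square_eval V \<phi> = square_eval V \<psi>"
  have "\<phi> (sym_prod (Sym2 V) (\<lambda>i. sq V (v i))) = \<psi> (sym_prod (Sym2 V) (\<lambda>i. sq V (v i)))" if "\<forall>i. v i \<in> V" for v
    using fun_cong[OF eq, of v] that by (simp add: square_eval_def)
  with d show "\<phi> = \<psi>" unfolding sym_power_Sym2[OF V] by (intro dual_eqI) auto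
qed

lemma identifies_square_eval:
  assumes V: "fin_dim V"
  shows "identifies (square_eval V)
      (dual (sym_power (Sym2 V))) (dual_cone (sym_cone (psd V)))
      {F. perm_invariant F \<and> F \<in> poly_fun V ` multiquad_polys (\<lambda>_::'n::finite. V)}
      {F. perm_invariant F \<and> F \<in> poly_fun V ` nonneg_multiquad_polys (\<lambda>_::'n. V)}"
proof -
  have subV: "subspace V" using V by (rule subspace_fin_dim)
  let ?D = "dual (sym_power (Sym2 V) :: ('n, _) multi_tensors set)"
  let ?Y = "{F. perm_invariant F \<and> F \<in> poly_fun V ` multiquad_polys (\<lambda>_::'n. V)}"
  have cone: "dual_cone (sym_cone (psd V)) = {\<phi> \<in> ?D. \<forall>v. 0 \<le> square_eval V \<phi> v}"
    unfolding sym_cone_psd[OF subV] dual_cone_hull sym_power_Sym2[OF subV]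
    by (auto simp: square_eval_def)
  have "Q \<in> nonneg_multiquad_polys (\<lambda>_::'n. V) \<longleftrightarrow>
      Q \<in> multiquad_polys (\<lambda>_::'n. V) \<and> (\<forall>v. 0 \<le> poly_fun V Q v)" for Q
    by (auto simp: nonneg_multiquad_polys_def poly_fun_def split: if_splits)
  then have nonneg: "{F. perm_invariant F \<and> F \<in> poly_fun V ` nonneg_multiquad_polys (\<lambda>_::'n. V)}
      = {F \<in> ?Y. \<forall>v. 0 \<le> F v}"
    by blast
  have img: "square_eval V ` ?D = ?Y"
  proof
    show "square_eval V ` ?D \<subseteq> ?Y"
      using square_eval_is_poly[OF V] square_eval_perm_invariant by blast
    show "?Y \<subseteq> square_eval V ` ?D"
    proof
      fix F assume "F \<in> ?Y"
      then obtain Q where F: "F = poly_fun V Q" and Q: "Q \<in> multiquad_polys (\<lambda>_::'n. V)"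
        and inv: "perm_invariant (poly_fun V Q)" by blast
      from perm_invariant_poly_is_square_eval[OF subV Q inv] obtain \<phi>
        where "\<phi> \<in> ?D" and eq: "square_eval V \<phi> = poly_fun V Q" by (rule bexE)
      then show "F \<in> square_eval V ` ?D" unfolding F eq[symmetric] by (intro imageI)
    qed
  qed
  have "linear_on ?D (square_eval V)"
    by (auto simp: linear_on_def square_eval_def fun_eq_iff)
  moreover have "bij_betw (square_eval V) ?D ?Y"
    using square_eval_inj[OF subV] img by (rule bij_betw_imageI)
  ultimately show ?thesis
    unfolding cone nonneg by (rule identifies_restrict)
qed

theorem lemma6p1:
  fixes V :: "'a::real_vector set" and W :: "'b::real_vector set"
    and U :: "'n::finite \<Rightarrow> 'c::real_vector set"
  assumes "fin_dim V" and "fin_dim W" and "\<And>i. fin_dim (U i)"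
  shows
    \<comment> \<open>(1)\<close>
    "identifies (sym2_pairing V) (Sym2 (dual V)) (psd (dual V)) (dual (Sym2 V)) (dual_cone (psd V)) \<and>
    \<comment> \<open>(2)\<close>
    tensor_cone (psd V) (psd W) =
      convex_cone hull {tensor (Sym2 V) (Sym2 W) (sq V v) (sq W w) | v w. v \<in> V \<and> w \<in> W} \<and>
    sym_cone (psd V) =
      convex_cone hull {sym_prod (Sym2 V) (\<lambda>i::'n. sq V (v i)) | v. \<forall>i. v i \<in> V} \<and>
    convex_cone hull {sym_prod (Sym2 V) (\<lambda>_::'n. sq V v) | v. v \<in> V} \<subseteq> sym_cone (psd V) \<and>
    (CARD('n) = 1 \<or> dim V \<le> 1 \<longrightarrow>
      sym_cone (psd V) = convex_cone hull {sym_prod (Sym2 V) (\<lambda>_::'n. sq V v) | v. v \<in> V}) \<and>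
    \<comment> \<open>(3)\<close>
    identifies (hom_pairing V W)
      (lin_maps (Sym2 V) (Sym2 (dual W))) (Hom_AC (psd V) (psd (dual W)))
      (dual (tensor_space (Sym2 V) (Sym2 W))) (dual_cone (tensor_cone (psd V) (psd W))) \<and>
    identifies (tensor_pairing V W)
      (biquad_polys V W) (nonneg_biquad_polys V W)
      (dual (tensor_space (Sym2 V) (Sym2 W))) (dual_cone (tensor_cone (psd V) (psd W))) \<and>
    identifies (multi_tensor_pairing U)
      (multiquad_polys U) (nonneg_multiquad_polys U)
      (dual (multi_tensor_space (\<lambda>i. Sym2 (U i)))) (dual_cone (multi_tensor_cone (\<lambda>i. psd (U i)))) \<and>
    \<comment> \<open>(4)\<close>
    identifies (square_eval V)
      (dual (sym_power (Sym2 V))) (dual_cone (sym_cone (psd V)))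
      {F. perm_invariant F \<and> F \<in> poly_fun V ` multiquad_polys (\<lambda>_::'n. V)}
      {F. perm_invariant F \<and> F \<in> poly_fun V ` nonneg_multiquad_polys (\<lambda>_::'n. V)}"
  using assms subspace_fin_dim[OF assms(1)] subspace_fin_dim[OF assms(2)]
  by (intro conjI impI identifies_psd_dual tensor_cone_psd sym_cone_psd veronese_cone_subset
      sym_cone_psd_veronese identifies_hom_pairing identifies_tensor_pairing
      identifies_multi_tensor_pairing identifies_square_eval)

end
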